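(* Let $W_\tau=\sum_{t=0}^{\tau-1}\alpha_t\,e^{S_t+V_t}$ be the terminal wealth and let $\Lambda=\sum_{t=0}^{\tau-1}\alpha_t V_t$, with standard deviation $\sigma_\Lambda$. The comonotonic lower bound $W_\tau^L=\sum_{t=0}^{\tau-1}\mathbb{E}\big(\alpha_t e^{S_t+V_t}\mid\Lambda\big)$ of $W_\tau$ is $$W_\tau^L=\sum_{t=0}^{\tau-1}\alpha_t\,\exp\Big\{\frac{\Lambda}{\sigma_\Lambda}\sqrt{\mathbf{x}^\top\mathbf{\Sigma}\,\mathbf{x}}\;c_{4,t}+c_{3,t}(\mathbf{x})+c_{2,t}\Big\},$$ where $$c_{2,t}=(\tau-t)r+\lambda(\tau-t)\Big(\prod_{j=1}^{m}M_{Z^\star_{1,j,0}(\mathbf{x})}(1)-1\Big)+\sum_{j=1}^{m}\lambda_j(\tau-t)\Big(M_{Z^\star_{1,j,1}(\mathbf{x})}(1)-1\Big),$$ $$c_{3,t}(\mathbf{x})=(\tau-t)(\boldsymbol{\mu}-r\mathbf{1})^\top\mathbf{x}-\frac12(\mathbf{x}^\top\mathbf{\Sigma}\,\mathbf{x})\frac{\big(\sum_{l=0}^{\tau-1}\alpha_l\min\{\tau-t,\tau-l\}\big)^2}{\sum_{k,l=0}^{\tau-1}\alpha_k\alpha_l\min\{\tau-k,\tau-l\}},$$ $$c_{4,t}=\frac{\sum_{l=0}^{\tau-1}\alpha_l\min\{\tau-t,\tau-l\}}{\sqrt{\sum_{k,l=0}^{\tau-1}\alpha_k\alpha_l\min\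{\tau-k,\tau-l\}}}.$$
   Context: Setting. $m\ge1$ risky assets, one risk-free asset with rate $r>0$, time horizon $\tau$ (a positive integer), and periodic endowments $\alpha_0,\dots,\alpha_{\tau-1}\ge 0$, not all zero, invested at times $0,\dots,\tau-1$. $B'_1,\dots,B'_m$ are (jointly Gaussian) standard Brownian motions with $\mathrm{Cov}(B'_i(t),B'_j(t+s))=t\,\rho_{i,j}$ for $t,s\ge0$. $N,N_1,\dots,N_m$ are independent Poisson processes with intensities $\lambda,\lambda_1,\dots,\lambda_m$. $Z_{k,j,\ell}$ ($k\ge1$, $1\le j\le m$, $\ell\in\{0,1\}$) are continuous real random variables (jump magnitudes of asset $j$ at the $k$-th jump of $N$ if $\ell=0$, of $N_j$ if $\ell=1$); for fixed $j$ they are i.i.d. over $k$ and $\ell$, and they are independent for different $j$. The family of Brownian motions, the Poisson processes and the jump magnitudes are independent of each other. Notation: $\sigma_j>0$ and $\mu_j\in\mathbb{R}$ are the volatilities and drifts; $h_{j,\ell}=\mathbb{E}[e^{Z_{k,j,\ell}}]-1$ (finite); $\boldsymbol{\mu}=(r+\mu_1-\lambda h_{1,0}-\lambda_1h_{1,1},\dots,r+\mu_m-\lambda h_{m,0}-\lambda_mh_{m,1})^\top$; $\mathbf{1}=(1,\dots,1)^\top$; $\mathbf{x}=(x_1,\dots,x_m)^\top$ is the constant vector of fractions of wealth in the risky assets; $\mu(\mathbf{x})=(\boldsymbol{\mu}-r\mathbf{1})^\top\mathbf{x}+r$; $\mathbf{\Sigma}=(\sigma_i\sigma_j\rho_{i,j})_{i,j}$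 with $\mathbf{x}^\top\mathbf{\Sigma}\mathbf{x}>0$; $B_{\mathbf{x}}(t)=\frac{1}{\mathbf{x}^\top\mathbf{\Sigma}\,\mathbf{x}}\sum_{j=1}^m x_j\sigma_jB'_j(t)$; $Z^\star_{k,j,\ell}(\mathbf{x})$ is the real random variable with $e^{Z^\star_{k,j,\ell}(\mathbf{x})}-1=x_j(e^{Z_{k,j,\ell}}-1)$ (assumed to exist); $M_Z(\theta)=\mathbb{E}(e^{\theta Z})$ is the moment generating function. For $0\le t\le\tau-1$, $$S_t=(\tau-t)\Big(\mu(\mathbf{x})-\frac{\mathbf{x}^\top\mathbf{\Sigma}\,\mathbf{x}}{2}\Big)+\sum_{j=1}^{m}\sum_{k=N(t)+1}^{N(\tau)}Z^\star_{k,j,0}(\mathbf{x})+\sum_{j=1}^{m}\sum_{k=N_j(t)+1}^{N_j(\tau)}Z^\star_{k,j,1}(\mathbf{x}),$$ $$V_t=(\mathbf{x}^\top\mathbf{\Sigma}\,\mathbf{x})\big(B_{\mathbf{x}}(\tau)-B_{\mathbf{x}}(t)\big).$$ The comonotonic lower bound of a sum $\sum_t X_t$ for a conditioning variable $\Lambda$ means $\sum_t\mathbb{E}(X_t\mid\Lambda)$. *)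

theory Defs
  imports "HOL-Probability.Probability"
begin

definition std_dev :: "'a measure \<Rightarrow> ('a \<Rightarrow> real) \<Rightarrow> real" where
  "std_dev M X = sqrt (prob_space.variance M X)"

definition covariance :: "'a measure \<Rightarrow> ('a \<Rightarrow> real) \<Rightarrow> ('a \<Rightarrow> real) \<Rightarrow> real" where
  "covariance M X Y =
     prob_space.expectation M
       (\<lambda>\<omega>. (X \<omega> - prob_space.expectation M X) * (Y \<omega> - prob_space.expectation M Y))"

definition mgf :: "'a measure \<Rightarrow> ('a \<Rightarrow> real) \<Rightarrow> real \<Rightarrow> real" where
  "mgf M X \<theta> = prob_space.expectation M (\<lambda>\<omega>. exp (\<theta> * X \<omega>))"

text \<open>Continuity is that of the distribution function; a density is not required.\<close>

definition continuous_rv :: "'a measure \<Rightarrow> ('a \<Rightarrow> real) \<Rightarrow> bool" where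
  "continuous_rv M X \<longleftrightarrow> X \<in> borel_measurable M \<and> continuous_on UNIV (cdf (distr M borel X))"

text \<open>Almost surely constant variables count as (degenerate) Gaussian, so that joint
  Gaussianity does not force the correlation matrix to be nonsingular.\<close>

definition gaussian_rv :: "'a measure \<Rightarrow> ('a \<Rightarrow> real) \<Rightarrow> bool" where
  "gaussian_rv M X \<longleftrightarrow>
     (\<exists>\<mu> \<sigma>. \<sigma> > 0 \<and> distributed M lborel X (normal_density \<mu> \<sigma>)) \<or>
     (X \<in> borel_measurable M \<and> (\<exists>c. AE \<omega> in M. X \<omega> = c))"

definition jointly_gaussian :: "'a measure \<Rightarrow> 'i set \<Rightarrow> ('i \<Rightarrow> 'a \<Rightarrow> real) \<Rightarrow> bool" where
  "jointly_gaussian M I X \<longleftrightarrow>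
     (\<forall>F a. finite F \<and> F \<subseteq> I \<longrightarrow> gaussian_rv M (\<lambda>\<omega>. \<Sum>i\<in>F. a i * X i \<omega>))"

text \<open>Processes are indexed by all reals, but only times \<open>t \<ge> 0\<close> are constrained.\<close>

definition independent_increments :: "'a measure \<Rightarrow> (real \<Rightarrow> 'a \<Rightarrow> real) \<Rightarrow> bool" where
  "independent_increments M X \<longleftrightarrow>
     (\<forall>n (s :: nat \<Rightarrow> real). 0 \<le> s 0 \<and> (\<forall>i<n. s i \<le> s (Suc i)) \<longrightarrow>
        prob_space.indep_vars M (\<lambda>_. borel) (\<lambda>i \<omega>. X (s (Suc i)) \<omega> - X (s i) \<omega>) {..<n})"

definition standard_brownian_motion :: "'a measure \<Rightarrow> (real \<Rightarrow> 'a \<Rightarrow> real) \<Rightarrow> bool" where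
  "standard_brownian_motion M B \<longleftrightarrow>
     (\<forall>t\<ge>0. B t \<in> borel_measurable M) \<and>
     (AE \<omega> in M. B 0 \<omega> = 0) \<and>
     (AE \<omega> in M. continuous_on {0..} (\<lambda>t. B t \<omega>)) \<and>
     independent_increments M B \<and>
     (\<forall>s t. 0 \<le> s \<and> s < t \<longrightarrow>
        distributed M lborel (\<lambda>\<omega>. B t \<omega> - B s \<omega>) (normal_density 0 (sqrt (t - s))))"

text \<open>The truncated natural subtraction \<open>N t \<omega> - N s \<omega>\<close> is the true increment for almost
  every \<open>\<omega>\<close>, because the paths are almost surely nondecreasing.\<close>

definition poisson_process :: "'a measure \<Rightarrow> real \<Rightarrow> (real \<Rightarrow> 'a \<Rightarrow> nat) \<Rightarrow> bool" where
  "poisson_process M rate N \<longleftrightarrow>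
     rate > 0 \<and>
     (\<forall>t\<ge>0. N t \<in> measurable M (count_space UNIV)) \<and>
     (AE \<omega> in M. N 0 \<omega> = 0 \<and> mono_on {0..} (\<lambda>t. N t \<omega>) \<and>
        (\<forall>t\<ge>0. continuous (at_right t) (\<lambda>s. N s \<omega>))) \<and>
     independent_increments M (\<lambda>t \<omega>. real (N t \<omega>)) \<and>
     (\<forall>s t. 0 \<le> s \<and> s < t \<longrightarrow>
        distr M (count_space UNIV) (\<lambda>\<omega>. N t \<omega> - N s \<omega>) =
        measure_pmf (poisson_pmf (rate * (t - s))))"

text \<open>The \<open>\<sigma>\<close>-algebra generated by a family of random elements of \<open>K\<close>.\<close>

definition generated_sigma ::
    "'a measure \<Rightarrow> 'b measure \<Rightarrow> 'i set \<Rightarrow> ('i \<Rightarrow> 'a \<Rightarrow> 'b) \<Rightarrow> 'a set set" where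
  "generated_sigma M K I X =
     sets (vimage_algebra (space M) (\<lambda>\<omega>. \<lambda>i\<in>I. X i \<omega>) (PiM I (\<lambda>_. K)))"

definition cond_exp_rv ::
    "'a measure \<Rightarrow> ('a \<Rightarrow> real) \<Rightarrow> ('a \<Rightarrow> real) \<Rightarrow> 'a \<Rightarrow> real" where
  "cond_exp_rv M X \<Lambda> = real_cond_exp M (vimage_algebra (space M) \<Lambda> borel) X"

text \<open>Lower bound of \<open>X 0 + \<dots> + X (n - 1)\<close> for the conditioning variable \<open>\<Lambda>\<close>; it depends on
  the summands, not only on their sum.\<close>

definition comonotonic_lower_bound ::
    "'a measure \<Rightarrow> nat \<Rightarrow> (nat \<Rightarrow> 'a \<Rightarrow> real) \<Rightarrow> ('a \<Rightarrow> real) \<Rightarrow> 'a \<Rightarrow> real" where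
  "comonotonic_lower_bound M n X \<Lambda> \<omega> = (\<Sum>t<n. cond_exp_rv M (X t) \<Lambda> \<omega>)"

end

theory Submission
  imports Defs
begin

text \<open>
  The jump part \<open>S t\<close> is independent of the Gaussian pair \<open>(V t, \<Lambda>)\<close>, so its exponential
  contributes the constant \<open>E (exp (S t))\<close>, the transform of a compound Poisson variable, which
  is computed by conditioning on the values of the counting processes. For the Gaussian pair, the
  residual \<open>V t - a * \<Lambda>\<close>, with \<open>a\<close> the regression coefficient, is uncorrelated with \<open>\<Lambda>\<close>; by
  factorisation of characteristic functions it is independent of \<open>\<Lambda>\<close>, so
  \<open>E (exp (V t) | \<Lambda>) = exp (a * \<Lambda> + v / 2)\<close> with \<open>v\<close> the residual variance.
\<close>

section \<open>Independence from characteristic functions\<close>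

text \<open>Nonnegative integrals carry the argument until its end: product formulas for independent
  factors then hold without integrability conditions, and finiteness is checked once, for
  \<open>X t\<close>. The candidate for the conditional expectation is tested against the events
  that \<open>\<Lambda>\<close> lies in a Borel set. Two obstacles shape the proof. The residual may
  vanish: for \<open>\<tau> = 1\<close> the variable \<open>V 0\<close> is a multiple of
  \<open>\<Lambda>\<close>. Degenerate Gaussians must therefore be covered, which rules out joint
  densities and motivates characteristic functions. Moreover, \<open>Zstar\<close> is tied to
  \<open>Z\<close> only almost surely, while independence is assumed for \<open>Z\<close>; so jumps
  enter through \<open>U\<close>, a genuine function of \<open>Z\<close> that agrees with
  \<open>exp Zstar\<close> almost surely. As for the constants, half the variance of
  \<open>V t\<close> cancels the drift correction \<open>- q / 2\<close> in \<open>S t\<close>. What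
  survives of the residual variance is minus the part explained by \<open>\<Lambda>\<close>, the
  quotient in \<open>c3\<close>. The summand \<open>c2\<close> is the riskless growth plus the
  exponent of the compound Poisson transform.\<close>

lemma (in prob_space) integrable_bounded_mult_iexp:
  assumes [measurable]: "g \<in> borel_measurable M" "Y \<in> borel_measurable M"
    and bdd: "\<And>\<omega>. \<bar>g \<omega>\<bar> \<le> C"
  shows "integrable M (\<lambda>\<omega>. complex_of_real (g \<omega>) * iexp (s * Y \<omega>))"
  by (rule integrable_const_bound[where B=C]) (use bdd in \<open>auto simp: norm_mult\<close>)

text \<open>Levy's uniqueness theorem applied to the law of \<open>Y\<close> under the probability measure with
  density \<open>g / expectation g\<close>.\<close>

lemma (in prob_space) expectation_indicator_of_iexp_factor:
  fixes g Y :: "'a \<Rightarrow> real"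
  assumes [measurable]: "g \<in> borel_measurable M" "Y \<in> borel_measurable M" "B \<in> sets borel"
    and nonneg: "\<And>\<omega>. 0 \<le> g \<omega>" and bdd: "\<And>\<omega>. g \<omega> \<le> C"
    and factor: "\<And>s. (CLINT \<omega>|M. g \<omega> * iexp (s * Y \<omega>)) =
      complex_of_real (expectation g) * (CLINT \<omega>|M. iexp (s * Y \<omega>))"
  shows "expectation (\<lambda>\<omega>. g \<omega> * indicator B (Y \<omega>)) =
    expectation g * expectation (\<lambda>\<omega>. indicator B (Y \<omega>))"
\<comment> \<open>Normalising \<open>g\<close> to a density needs a positive mean. A nonnegative
  \<open>g\<close> with mean zero vanishes almost surely, and both sides are zero.\<close>
proof (cases "expectation g = 0")
  have int [simp]: "integrable M g"
    by (rule integrable_const_bound[where B=C]) (use nonneg bdd in auto)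
  case True
  then have "AE \<omega> in M. g \<omega> = 0"
    using integral_nonneg_eq_0_iff_AE[OF int] nonneg by auto
  then have "expectation (\<lambda>\<omega>. g \<omega> * indicator B (Y \<omega>)) = expectation (\<lambda>_. 0)"
    by (intro integral_cong_AE) auto
  then show ?thesis by (simp add: True)
next
  have int [simp]: "integrable M g"
    by (rule integrable_const_bound[where B=C]) (use nonneg bdd in auto)
  case False
  then have pos: "0 < expectation g"
    using Bochner_Integration.integral_nonneg[of M g] nonneg by (auto simp: less_le)
  define K where "K = expectation g"
  have K: "0 < K" using pos by (simp add: K_def)
  define Q where "Q = density M (\<lambda>\<omega>. ennreal (g \<omega> / K))"
  have "emeasure Q (space Q) = (\<integral>\<^sup>+ \<omega>. ennreal (g \<omega> / K) \<partial>M)"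
    unfolding Q_def by (simp add: emeasure_density cong: nn_integral_cong)
  also have "\<dots> = ennreal (\<integral> \<omega>. g \<omega> / K \<partial>M)"
    by (rule nn_integral_eq_integral) (use K nonneg in auto)
  also have "\<dots> = 1" using K by (simp add: K_def)
  finally interpret Q: prob_space Q by (rule prob_spaceI)
  have [measurable]: "Y \<in> borel_measurable Q" by (simp add: Q_def)
  \<comment> \<open>Hypothesis \<open>factor\<close> says precisely that reweighting by
    \<open>g / K\<close> does not change the characteristic function of \<open>Y\<close>.\<close>
  have char_eq: "char (distr Q borel Y) = char (distr M borel Y)"
  proof
    fix s
    have "char (distr Q borel Y) s = (CLINT \<omega>|Q. iexp (s * Y \<omega>))"
      by (simp add: char_def integral_distr)
    also have "\<dots> = (CLINT \<omega>|M. (g \<omega> / K) *\<^sub>R iexp (s * Y \<omega>))"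
      unfolding Q_def by (rule integral_density) (use K nonneg in auto)
    also have "\<dots> = (CLINT \<omega>|M. (1 / K) *\<^sub>R (g \<omega> * iexp (s * Y \<omega>)))"
      by (simp add: scaleR_conv_of_real)
    also have "\<dots> = (1 / K) *\<^sub>R (CLINT \<omega>|M. g \<omega> * iexp (s * Y \<omega>))"
      by (rule integral_scaleR_right)
    also have "\<dots> = (CLINT \<omega>|M. iexp (s * Y \<omega>))"
      unfolding factor using K by (simp add: K_def[symmetric] scaleR_conv_of_real)
    also have "\<dots> = char (distr M borel Y) s"
      by (simp add: char_def integral_distr)
    finally show "char (distr Q borel Y) s = char (distr M borel Y) s" .
  qed
  have "distr Q borel Y = distr M borel Y"
    by (rule Levy_uniqueness[OF _ _ char_eq])
      (auto simp: real_distribution_def real_distribution_axioms_def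
        intro!: Q.prob_space_distr prob_space_distr)
  then have "(\<integral>\<omega>. indicator B (Y \<omega>) \<partial>Q) = (\<integral>\<omega>. indicator B (Y \<omega>) \<partial>M :: real)"
    using integral_distr[of Y Q borel "indicator B :: real \<Rightarrow> real"]
      integral_distr[of Y M borel "indicator B :: real \<Rightarrow> real"] by simp
  moreover have "(\<integral>\<omega>. indicator B (Y \<omega>) \<partial>Q) = (\<integral>\<omega>. (g \<omega> / K) *\<^sub>R (indicator B (Y \<omega>) :: real) \<partial>M)"
    unfolding Q_def by (rule integral_density) (use K nonneg in auto)
  ultimately show ?thesis using K by (simp add: field_simps K_def[symmetric])
qed

text \<open>The preceding lemma is used twice: with \<open>g = 2 + cos (s * X + c)\<close>, shifted to be positive, and then
  with the roles exchanged and \<open>g\<close> the indicator of an event \<open>Y \<in> B\<close>.\<close>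

lemma (in prob_space) indep_var_of_char:
  fixes X Y :: "'a \<Rightarrow> real"
  assumes [measurable]: "X \<in> borel_measurable M" "Y \<in> borel_measurable M"
    and factor: "\<And>s t. (CLINT \<omega>|M. iexp (s * X \<omega> + t * Y \<omega>)) =
      (CLINT \<omega>|M. iexp (s * X \<omega>)) * (CLINT \<omega>|M. iexp (t * Y \<omega>))"
  shows "indep_var borel X borel Y"
proof -
  have int1 [simp]: "integrable M (\<lambda>\<omega>. iexp (Z \<omega>))" if [measurable]: "Z \<in> borel_measurable M" for Z
    by (rule integrable_iexp) auto
  have lin: "(CLINT \<omega>|M. (a * f \<omega> + b * g \<omega>) / 2) = (a * integral\<^sup>L M f + b * integral\<^sup>L M g) / 2"
    if "integrable M f" "integrable M g" for a b :: complex and f g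
    using that by simp
  \<comment> \<open>A density must be real, so the complex exponential in \<open>X\<close> is
    replaced by a cosine with free phase \<open>c\<close>: phase 0 gives the cosine and phase
    \<open>- (pi/2)\<close> the sine. The cosine is a combination of exponentials with frequencies
    \<open>s\<close> and \<open>- s\<close>, and \<open>factor\<close> applies to each.\<close>
  have step: "(CLINT \<omega>|M. cos (s * X \<omega> + c) * iexp (t * Y \<omega>)) =
      complex_of_real (expectation (\<lambda>\<omega>. cos (s * X \<omega> + c))) * (CLINT \<omega>|M. iexp (t * Y \<omega>))" for s t c
  proof -
    have eq: "complex_of_real (cos (s * x + c)) =
        (iexp c * iexp (s * x) + iexp (- c) * iexp ((- s) * x)) / 2" for x
      by (simp add: cos_exp_eq cos_of_real[symmetric] exp_add[symmetric] algebra_simps)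
    have "complex_of_real (expectation (\<lambda>\<omega>. cos (s * X \<omega> + c))) =
        (CLINT \<omega>|M. complex_of_real (cos (s * X \<omega> + c)))"
      by simp
    also have "\<dots> = (iexp c * (CLINT \<omega>|M. iexp (s * X \<omega>)) +
        iexp (- c) * (CLINT \<omega>|M. iexp ((- s) * X \<omega>))) / 2"
      unfolding eq by (intro lin int1) auto
    finally have E: "complex_of_real (expectation (\<lambda>\<omega>. cos (s * X \<omega> + c))) = \<dots>" .
    have "(CLINT \<omega>|M. cos (s * X \<omega> + c) * iexp (t * Y \<omega>)) =
      (CLINT \<omega>|M. (iexp c * iexp (s * X \<omega> + t * Y \<omega>) +
        iexp (- c) * iexp ((- s) * X \<omega> + t * Y \<omega>)) / 2)"
      unfolding eq by (simp add: exp_add exp_diff exp_minus field_simps)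
    also have "\<dots> = (iexp c * (CLINT \<omega>|M. iexp (s * X \<omega> + t * Y \<omega>)) +
        iexp (- c) * (CLINT \<omega>|M. iexp ((- s) * X \<omega> + t * Y \<omega>))) / 2"
      by (intro lin int1) auto
    also have "\<dots> = complex_of_real (expectation (\<lambda>\<omega>. cos (s * X \<omega> + c))) * (CLINT \<omega>|M. iexp (t * Y \<omega>))"
      unfolding factor E by (simp add: algebra_simps add_divide_distrib)
    finally show ?thesis .
  qed
  have cosB: "expectation (\<lambda>\<omega>. cos (s * X \<omega> + c) * indicator B (Y \<omega>)) =
      expectation (\<lambda>\<omega>. cos (s * X \<omega> + c)) * expectation (\<lambda>\<omega>. indicator B (Y \<omega>))"
    if [measurable]: "B \<in> sets borel" for s c B
  proof -
    have ic [simp]: "integrable M (\<lambda>\<omega>. cos (s * X \<omega> + c))"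
      by (rule integrable_const_bound[where B=1]) auto
    have ii [simp]: "integrable M (\<lambda>\<omega>. indicator B (Y \<omega>) :: real)"
      by (rule integrable_const_bound[where B=1]) (auto simp: indicator_def)
    have ici [simp]: "integrable M (\<lambda>\<omega>. cos (s * X \<omega> + c) * indicator B (Y \<omega>))"
      by (rule integrable_const_bound[where B=1]) (auto simp: indicator_def)
    have e: "expectation (\<lambda>\<omega>. 2 + cos (s * X \<omega> + c)) = 2 + expectation (\<lambda>\<omega>. cos (s * X \<omega> + c))"
      by (simp add: prob_space)
    have "expectation (\<lambda>\<omega>. (2 + cos (s * X \<omega> + c)) * indicator B (Y \<omega>)) =
      expectation (\<lambda>\<omega>. 2 + cos (s * X \<omega> + c)) * expectation (\<lambda>\<omega>. indicator B (Y \<omega>))"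
    proof (rule expectation_indicator_of_iexp_factor[where C=3])
      fix t
      have "(CLINT \<omega>|M. complex_of_real (2 + cos (s * X \<omega> + c)) * iexp (t * Y \<omega>)) =
         (CLINT \<omega>|M. 2 * iexp (t * Y \<omega>) + cos (s * X \<omega> + c) * iexp (t * Y \<omega>))"
        by (simp add: algebra_simps)
      also have "\<dots> = 2 * (CLINT \<omega>|M. iexp (t * Y \<omega>)) + (CLINT \<omega>|M. cos (s * X \<omega> + c) * iexp (t * Y \<omega>))"
        by (subst Bochner_Integration.integral_add)
          (auto intro!: integrable_bounded_mult_iexp[where C=1] integrable_mult_right int1
             simp del: of_real_mult)
      finally show "(CLINT \<omega>|M. complex_of_real (2 + cos (s * X \<omega> + c)) * iexp (t * Y \<omega>)) =
         complex_of_real (expectation (\<lambda>\<omega>. 2 + cos (s * X \<omega> + c))) * (CLINT \<omega>|M. iexp (t * Y \<omega>))"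
        unfolding step e by (simp add: algebra_simps)
      show "0 \<le> 2 + cos (s * X \<omega> + c)" "2 + cos (s * X \<omega> + c) \<le> 3" for \<omega>
        using cos_ge_minus_one[of "s * X \<omega> + c"] cos_le_one[of "s * X \<omega> + c"] by linarith+
    qed measurable
    then show ?thesis unfolding e by (simp add: distrib_right)
  qed
  \<comment> \<open>Now the indicator of the \<open>Y\<close>-event is the weight and
    \<open>X\<close> is the variable whose law is compared. The required factorisation is
    \<open>cosB\<close> for the real and imaginary parts of
    \<open>iexp (s * X \<omega>)\<close>.\<close>
  have main: "expectation (\<lambda>\<omega>. indicat_real B (Y \<omega>) * indicat_real A (X \<omega>)) =
      expectation (\<lambda>\<omega>. indicat_real B (Y \<omega>)) * expectation (\<lambda>\<omega>. indicat_real A (X \<omega>))"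
    if [measurable]: "A \<in> sets borel" "B \<in> sets borel" for A B
  proof (rule expectation_indicator_of_iexp_factor[where C=1])
    fix s
    have ic [simp]: "integrable M (\<lambda>\<omega>. cos (s * X \<omega>))" "integrable M (\<lambda>\<omega>. sin (s * X \<omega>))"
      "integrable M (\<lambda>\<omega>. cos (s * X \<omega>) * indicator B (Y \<omega>))"
      "integrable M (\<lambda>\<omega>. sin (s * X \<omega>) * indicator B (Y \<omega>))"
      by (rule integrable_const_bound[where B=1]; auto simp: indicator_def)+
    have iexp_eq: "iexp y = complex_of_real (cos y) + \<i> * complex_of_real (sin y)" for y
      by (simp add: exp_Euler cos_of_real sin_of_real)
    have s: "cos (y + - (pi/2)) = sin y" for y :: real by (simp add: cos_diff)
    have c: "expectation (\<lambda>\<omega>. cos (s * X \<omega>) * indicator B (Y \<omega>)) =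
      expectation (\<lambda>\<omega>. cos (s * X \<omega>)) * expectation (\<lambda>\<omega>. indicator B (Y \<omega>))"
      using cosB[of B s 0] by simp
    have s: "expectation (\<lambda>\<omega>. sin (s * X \<omega>) * indicator B (Y \<omega>)) =
      expectation (\<lambda>\<omega>. sin (s * X \<omega>)) * expectation (\<lambda>\<omega>. indicator B (Y \<omega>))"
      using cosB[of B s "- (pi/2)"] unfolding s by simp
    have "(CLINT \<omega>|M. complex_of_real (indicator B (Y \<omega>)) * iexp (s * X \<omega>)) =
      (CLINT \<omega>|M. complex_of_real (cos (s * X \<omega>) * indicator B (Y \<omega>)) +
         \<i> * complex_of_real (sin (s * X \<omega>) * indicator B (Y \<omega>)))"
      unfolding iexp_eq by (simp add: algebra_simps)
    also have "\<dots> = complex_of_real (expectation (\<lambda>\<omega>. cos (s * X \<omega>) * indicator B (Y \<omega>))) +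
        \<i> * complex_of_real (expectation (\<lambda>\<omega>. sin (s * X \<omega>) * indicator B (Y \<omega>)))"
      by (subst Bochner_Integration.integral_add) (auto simp del: of_real_mult)
    also have "\<dots> = complex_of_real (expectation (\<lambda>\<omega>. indicator B (Y \<omega>))) *
       ((CLINT \<omega>|M. complex_of_real (cos (s * X \<omega>))) + \<i> * (CLINT \<omega>|M. complex_of_real (sin (s * X \<omega>))))"
      unfolding c s by (simp add: distrib_left mult_ac)
    also have "\<dots> = complex_of_real (expectation (\<lambda>\<omega>. indicator B (Y \<omega>))) * (CLINT \<omega>|M. iexp (s * X \<omega>))"
      unfolding iexp_eq by (subst Bochner_Integration.integral_add) auto
    finally show "(CLINT \<omega>|M. complex_of_real (indicator B (Y \<omega>)) * iexp (s * X \<omega>)) = \<dots>" .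
  qed (auto simp: indicator_def)
  have prob_eq: "expectation (\<lambda>\<omega>. indicator A (f \<omega>)) = prob (f -` A \<inter> space M)" for A :: "real set" and f
  proof -
    have "indicat_real A (f \<omega>) = indicator (f -` A) \<omega>" for \<omega> by (simp add: indicator_def)
    then show ?thesis by simp
  qed
  show ?thesis
    unfolding indep_var_eq
  proof (intro conjI)
    show "indep_set (sigma_sets (space M) {X -` A \<inter> space M |A. A \<in> sets borel})
      (sigma_sets (space M) {Y -` A \<inter> space M |A. A \<in> sets borel})"
    proof (rule indep_set_sigma_sets)
      show "Int_stable {X -` A \<inter> space M |A. A \<in> sets borel}"
        "Int_stable {Y -` A \<inter> space M |A. A \<in> sets borel}"
        by (auto simp: Int_stable_def) (metis (no_types) sets.Int vimage_Int inf_assoc inf_left_commute inf.idem)+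
      show "indep_set {X -` A \<inter> space M |A. A \<in> sets borel} {Y -` A \<inter> space M |A. A \<in> sets borel}"
        unfolding indep_sets2_eq
      proof (safe)
        fix A B :: "real set" assume AB: "A \<in> sets borel" "B \<in> sets borel"
        have "expectation (\<lambda>\<omega>. indicator B (Y \<omega>) * indicator A (X \<omega>) :: real) =
            prob (X -` A \<inter> space M \<inter> (Y -` B \<inter> space M))"
        proof -
          have "expectation (\<lambda>\<omega>. indicator B (Y \<omega>) * indicator A (X \<omega>) :: real) =
            expectation (indicator (X -` A \<inter> Y -` B))"
            by (intro Bochner_Integration.integral_cong) (auto simp: indicator_def)
          also have "\<dots> = prob (X -` A \<inter> Y -` B \<inter> space M)"
            by simp
          finally show ?thesis by (simp add: Int_ac)
        qed
        then show "prob (X -` A \<inter> space M \<inter> (Y -` B \<inter> space M)) =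
          prob (X -` A \<inter> space M) * prob (Y -` B \<inter> space M)"
          using main[OF AB] by (simp add: prob_eq mult.commute)
      qed auto
    qed
  qed auto
qed

section \<open>Gaussian variables\<close>

text \<open>Zero belongs to this class because \<open>gaussian_rv\<close> admits constants;
  regression residuals may be zero.\<close>

definition centered_gaussian :: "'a measure \<Rightarrow> ('a \<Rightarrow> real) \<Rightarrow> bool" where
  "centered_gaussian M X \<longleftrightarrow> gaussian_rv M X \<and> prob_space.expectation M X = 0"

text \<open>Completing the square: the exponential weight moves the mean from 0 to
  \<open>\<sigma>\<^sup>2\<close> and leaves the factor
  \<open>exp (\<sigma>\<^sup>2 / 2)\<close>.\<close>

lemma nn_integral_exp_normal_density:
  assumes "0 < \<sigma>"
  shows "(\<integral>\<^sup>+x. ennreal (normal_density 0 \<sigma> x) * ennreal (exp x) \<partial>lborel) = ennreal (exp (\<sigma>\<^sup>2 / 2))"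
proof -
  have "normal_density 0 \<sigma> x * exp x = exp (\<sigma>\<^sup>2 / 2) * normal_density (\<sigma>\<^sup>2) \<sigma> x" for x
  proof -
    have "- x\<^sup>2 / (2 * \<sigma>\<^sup>2) + x = \<sigma>\<^sup>2 / 2 + - (x - \<sigma>\<^sup>2)\<^sup>2 / (2 * \<sigma>\<^sup>2)"
      using assms by (simp add: field_simps power2_eq_square)
    then have "exp (- x\<^sup>2 / (2 * \<sigma>\<^sup>2)) * exp x = exp (\<sigma>\<^sup>2 / 2) * exp (- (x - \<sigma>\<^sup>2)\<^sup>2 / (2 * \<sigma>\<^sup>2))"
      by (simp only: exp_add[symmetric])
    then show ?thesis by (simp add: normal_density_def)
  qed
  then have "(\<integral>\<^sup>+x. ennreal (normal_density 0 \<sigma> x) * ennreal (exp x) \<partial>lborel) =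
      (\<integral>\<^sup>+x. ennreal (exp (\<sigma>\<^sup>2 / 2)) * ennreal (normal_density (\<sigma>\<^sup>2) \<sigma> x) \<partial>lborel)"
    by (simp add: ennreal_mult[symmetric])
  also have "\<dots> = ennreal (exp (\<sigma>\<^sup>2 / 2))"
    using assms by (simp add: nn_integral_cmult nn_integral_eq_integral integrable_normal_density integral_normal_density)
  finally show ?thesis .
qed

context prob_space
begin

lemma gaussian_rv_measurable: "gaussian_rv M X \<Longrightarrow> X \<in> borel_measurable M"
  by (auto simp: gaussian_rv_def distributed_def)

text \<open>Mean zero forces the constant of the degenerate case to be zero. The second moment is
  recorded in both cases so that later transforms are stated in it alone, uniformly for degenerate
  and nondegenerate variables.\<close>

lemma centered_gaussian_cases:
  assumes "centered_gaussian M X"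
  obtains \<sigma> where "0 < \<sigma>" "distributed M lborel X (normal_density 0 \<sigma>)" "expectation (\<lambda>\<omega>. (X \<omega>)\<^sup>2) = \<sigma>\<^sup>2"
  | "AE \<omega> in M. X \<omega> = 0" "expectation (\<lambda>\<omega>. (X \<omega>)\<^sup>2) = 0"
proof -
  have mean: "expectation X = 0" and g: "gaussian_rv M X"
    using assms by (auto simp: centered_gaussian_def)
  have [measurable]: "X \<in> borel_measurable M" by (rule gaussian_rv_measurable[OF g])
  from g consider m \<sigma> where "0 < \<sigma>" "distributed M lborel X (normal_density m \<sigma>)" | c where "AE \<omega> in M. X \<omega> = c"
    by (auto simp: gaussian_rv_def)
  then show thesis
  proof cases
    case 1
    then have "m = 0" using normal_distributed_expectation[OF 1] mean by simp
    then show thesis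
      using that(1)[OF 1(1)] 1 normal_distributed_variance[OF 1] mean by simp
  next
    case 2
    then have "expectation X = expectation (\<lambda>_. c)" by (intro integral_cong_AE) auto
    then have c: "c = 0" using mean by (simp add: prob_space)
    have "expectation (\<lambda>\<omega>. (X \<omega>)\<^sup>2) = expectation (\<lambda>_. 0)"
      using 2 c by (intro integral_cong_AE) auto
    then show thesis using that(2) 2 c by simp
  qed
qed

lemma centered_gaussian_square_integrable:
  assumes "centered_gaussian M X"
  shows "integrable M (\<lambda>\<omega>. (X \<omega>)\<^sup>2)"
  using assms
proof (cases rule: centered_gaussian_cases)
  case (1 \<sigma>)
  have "integrable lborel (\<lambda>x. normal_density 0 \<sigma> x * (x - 0)^(2 * 1))"
    by (rule integrable_normal_moment) (use 1 in auto)
  then have "integrable lborel (\<lambda>x. normal_density 0 \<sigma> x * x\<^sup>2)" by simp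
  then show ?thesis
    by (subst distributed_integrable[OF 1(2), symmetric]) auto
next
  case 2
  have [measurable]: "X \<in> borel_measurable M"
    using assms by (auto simp: centered_gaussian_def gaussian_rv_measurable)
  have "integrable M (\<lambda>\<omega>. 0::real)" by simp
  then show ?thesis by (rule integrable_cong_AE_imp) (use 2 in auto)
qed

lemma centered_gaussian_iexp:
  assumes "centered_gaussian M X"
  shows "(CLINT \<omega>|M. iexp (X \<omega>)) = exp (- expectation (\<lambda>\<omega>. (X \<omega>)\<^sup>2) / 2)"
  using assms
proof (cases rule: centered_gaussian_cases)
  case (1 \<sigma>)
  have [measurable]: "X \<in> borel_measurable M"
    using assms by (auto simp: centered_gaussian_def gaussian_rv_measurable)
  have "distributed M lborel (\<lambda>\<omega>. (X \<omega> - 0) / \<sigma>) std_normal_density"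
    using 1 normal_standard_normal_convert[of \<sigma> X 0] by simp
  then have d: "distr M borel (\<lambda>\<omega>. X \<omega> / \<sigma>) = std_normal_distribution"
    by (simp add: distributed_def cong: distr_cong)
  \<comment> \<open>The characteristic function of \<open>X\<close> at 1 is that of the standardised
    variable at \<open>\<sigma>\<close>.\<close>
  have "(CLINT \<omega>|M. iexp (X \<omega>)) = char (distr M borel (\<lambda>\<omega>. X \<omega> / \<sigma>)) \<sigma>"
    using 1 by (simp add: char_def integral_distr)
  also have "\<dots> = exp (- (\<sigma>\<^sup>2) / 2)" unfolding d char_std_normal_distribution ..
  finally show ?thesis by (simp add: 1)
next
  case 2
  have [measurable]: "X \<in> borel_measurable M"
    using assms by (auto simp: centered_gaussian_def gaussian_rv_measurable)
  have "(CLINT \<omega>|M. iexp (X \<omega>)) = (CLINT \<omega>|M. 1)"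
    by (intro integral_cong_AE) (use 2 in auto)
  then show ?thesis using 2 by (simp add: prob_space)
qed

lemma centered_gaussian_exp:
  assumes "centered_gaussian M X"
  shows "(\<integral>\<^sup>+\<omega>. ennreal (exp (X \<omega>)) \<partial>M) = ennreal (exp (expectation (\<lambda>\<omega>. (X \<omega>)\<^sup>2) / 2))"
  using assms
proof (cases rule: centered_gaussian_cases)
  case (1 \<sigma>)
  then show ?thesis
    using nn_integral_exp_normal_density[of \<sigma>]
      distributed_nn_integral[OF 1(2), of "\<lambda>x. ennreal (exp x)"] by simp
next
  case 2
  have "(\<integral>\<^sup>+\<omega>. ennreal (exp (X \<omega>)) \<partial>M) = (\<integral>\<^sup>+\<omega>. 1 \<partial>M)"
    by (intro nn_integral_cong_AE) (use 2 in auto)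
  then show ?thesis using 2 by (simp add: emeasure_space_1)
qed

lemma integrable_mult_of_squares:
  fixes X Y :: "'a \<Rightarrow> real"
  assumes [measurable]: "X \<in> borel_measurable M" "Y \<in> borel_measurable M"
    and int: "integrable M (\<lambda>\<omega>. (X \<omega>)\<^sup>2)" "integrable M (\<lambda>\<omega>. (Y \<omega>)\<^sup>2)"
  shows "integrable M (\<lambda>\<omega>. X \<omega> * Y \<omega>)"
proof (rule Bochner_Integration.integrable_bound)
  show "integrable M (\<lambda>\<omega>. (X \<omega>)\<^sup>2 + (Y \<omega>)\<^sup>2)" using int by simp
  have "\<bar>x * y\<bar> \<le> x\<^sup>2 + y\<^sup>2" for x y :: real
  proof -
    have "2 * \<bar>x\<bar> * \<bar>y\<bar> \<le> x\<^sup>2 + y\<^sup>2" using sum_squares_bound[of "\<bar>x\<bar>" "\<bar>y\<bar>"] by simp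
    moreover have "0 \<le> x\<^sup>2 + y\<^sup>2" by simp
    ultimately show ?thesis unfolding abs_mult by linarith
  qed
  then show "AE \<omega> in M. norm (X \<omega> * Y \<omega>) \<le> norm ((X \<omega>)\<^sup>2 + (Y \<omega>)\<^sup>2)" by auto
qed measurable

lemma indep_var_nn_integral:
  fixes X Y :: "'a \<Rightarrow> ennreal"
  assumes "indep_var borel X borel Y"
  shows "(\<integral>\<^sup>+\<omega>. X \<omega> * Y \<omega> \<partial>M) = (\<integral>\<^sup>+\<omega>. X \<omega> \<partial>M) * (\<integral>\<^sup>+\<omega>. Y \<omega> \<partial>M)"
proof -
  have "case_bool borel borel = (\<lambda>_. borel :: ennreal measure)"
    by (auto split: bool.split)
  then have "indep_vars (\<lambda>_. borel) (case_bool X Y) UNIV"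
    using assms by (simp add: indep_var_def)
  from indep_vars_nn_integral[OF _ this] show ?thesis by (simp add: UNIV_bool mult.commute)
qed

text \<open>This is the formula for the conditional expectation of \<open>exp X\<close> given
  \<open>Y\<close>, in the tested form that \<open>cond_exp_rv_charact\<close> consumes. The
  subtracted quotient is the part of the variance of \<open>X\<close> explained by
  \<open>Y\<close>.\<close>

lemma centered_gaussian_regression:
  fixes X Y :: "'a \<Rightarrow> real"
  assumes lin: "\<And>u v. centered_gaussian M (\<lambda>\<omega>. u * X \<omega> + v * Y \<omega>)"
    and pos: "0 < expectation (\<lambda>\<omega>. (Y \<omega>)\<^sup>2)"
    and A [measurable]: "A \<in> sets borel"
  defines "a \<equiv> expectation (\<lambda>\<omega>. X \<omega> * Y \<omega>) / expectation (\<lambda>\<omega>. (Y \<omega>)\<^sup>2)"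
  shows "(\<integral>\<^sup>+\<omega>. ennreal (exp (X \<omega>)) * indicator A (Y \<omega>) \<partial>M) =
    (\<integral>\<^sup>+\<omega>. ennreal (exp (a * Y \<omega> + (expectation (\<lambda>\<omega>. (X \<omega>)\<^sup>2)
       - (expectation (\<lambda>\<omega>. X \<omega> * Y \<omega>))\<^sup>2 / expectation (\<lambda>\<omega>. (Y \<omega>)\<^sup>2)) / 2)) * indicator A (Y \<omega>) \<partial>M)"
proof -
  have gX: "centered_gaussian M X" and gY: "centered_gaussian M Y"
    using lin[of 1 0] lin[of 0 1] by simp_all
  then have [measurable]: "X \<in> borel_measurable M" "Y \<in> borel_measurable M"
    by (auto simp: centered_gaussian_def gaussian_rv_measurable)
  note [simp] = centered_gaussian_square_integrable[OF gX] centered_gaussian_square_integrable[OF gY]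
  have [simp]: "integrable M (\<lambda>\<omega>. X \<omega> * Y \<omega>)" by (rule integrable_mult_of_squares) auto
  define vX where "vX = expectation (\<lambda>\<omega>. (X \<omega>)\<^sup>2)"
  define vY where "vY = expectation (\<lambda>\<omega>. (Y \<omega>)\<^sup>2)"
  define c where "c = expectation (\<lambda>\<omega>. X \<omega> * Y \<omega>)"
  have vY: "0 < vY" using pos by (simp add: vY_def)
  have a: "a = c / vY" by (simp add: a_def c_def vY_def)
  define R where "R = (\<lambda>\<omega>. X \<omega> - a * Y \<omega>)"
  have [measurable]: "R \<in> borel_measurable M" by (simp add: R_def)
  have var: "expectation (\<lambda>\<omega>. (u * X \<omega> + v * Y \<omega>)\<^sup>2) = u\<^sup>2 * vX + 2 * u * v * c + v\<^sup>2 * vY" for u v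
  proof -
    have "(\<lambda>\<omega>. (u * X \<omega> + v * Y \<omega>)\<^sup>2) =
      (\<lambda>\<omega>. u\<^sup>2 * (X \<omega>)\<^sup>2 + (2 * u * v) * (X \<omega> * Y \<omega>) + v\<^sup>2 * (Y \<omega>)\<^sup>2)"
      by (auto simp: power2_eq_square algebra_simps)
    then show ?thesis by (simp add: vX_def vY_def c_def)
  qed
  have RY: "s * R \<omega> + t * Y \<omega> = s * X \<omega> + (t - s * a) * Y \<omega>" for s t \<omega>
    by (simp add: R_def algebra_simps)
  have gRY: "centered_gaussian M (\<lambda>\<omega>. s * R \<omega> + t * Y \<omega>)" for s t
    unfolding RY by (rule lin)
  \<comment> \<open>The choice of \<open>a\<close> cancels the mixed term in \<open>s * t\<close>.
    Since a centered Gaussian transform depends only on the second moment, the joint characteristic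
    function of \<open>R\<close> and \<open>Y\<close> then factors.\<close>
  have vRY: "expectation (\<lambda>\<omega>. (s * R \<omega> + t * Y \<omega>)\<^sup>2) = s\<^sup>2 * (vX - c\<^sup>2 / vY) + t\<^sup>2 * vY" for s t
    unfolding RY var a using vY by (simp add: field_simps power2_eq_square)
  have gR: "centered_gaussian M R" and vR: "expectation (\<lambda>\<omega>. (R \<omega>)\<^sup>2) = vX - c\<^sup>2 / vY"
    using gRY[of 1 0] vRY[of 1 0] by simp_all
  have indep: "indep_var borel R borel Y"
  proof (rule indep_var_of_char)
    fix s t
    have "exp (- (s\<^sup>2 * (vX - c\<^sup>2 / vY) + t\<^sup>2 * vY) / 2) =
        exp (- (s\<^sup>2 * (vX - c\<^sup>2 / vY)) / 2) * exp (- (t\<^sup>2 * vY) / 2)"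
      by (simp add: exp_add[symmetric] add_divide_distrib diff_divide_distrib)
    then show "(CLINT \<omega>|M. iexp (s * R \<omega> + t * Y \<omega>)) =
      (CLINT \<omega>|M. iexp (s * R \<omega>)) * (CLINT \<omega>|M. iexp (t * Y \<omega>))"
      using centered_gaussian_iexp[OF gRY[of s t]] centered_gaussian_iexp[OF gRY[of s 0]]
        centered_gaussian_iexp[OF gRY[of 0 t]]
      unfolding vRY by simp
  qed measurable
  have R2: "indep_var borel (\<lambda>\<omega>. ennreal (exp (R \<omega>))) borel (\<lambda>\<omega>. ennreal (exp (a * Y \<omega>)) * indicator A (Y \<omega>))"
    using indep_var_compose[OF indep, of "\<lambda>x. ennreal (exp x)" borel "\<lambda>y. ennreal (exp (a * y)) * indicator A y" borel]
    by (simp add: comp_def)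
  have "(\<integral>\<^sup>+\<omega>. ennreal (exp (X \<omega>)) * indicator A (Y \<omega>) \<partial>M) =
    (\<integral>\<^sup>+\<omega>. ennreal (exp (R \<omega>)) * (ennreal (exp (a * Y \<omega>)) * indicator A (Y \<omega>)) \<partial>M)"
    by (intro nn_integral_cong)
      (simp add: mult.assoc[symmetric] ennreal_mult[symmetric] exp_add[symmetric] R_def)
  also have "\<dots> = (\<integral>\<^sup>+\<omega>. ennreal (exp (R \<omega>)) \<partial>M) * (\<integral>\<^sup>+\<omega>. ennreal (exp (a * Y \<omega>)) * indicator A (Y \<omega>) \<partial>M)"
    by (rule indep_var_nn_integral[OF R2])
  also have "\<dots> = (\<integral>\<^sup>+\<omega>. ennreal (exp ((vX - c\<^sup>2 / vY) / 2)) * (ennreal (exp (a * Y \<omega>)) * indicator A (Y \<omega>)) \<partial>M)"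
    unfolding centered_gaussian_exp[OF gR] vR by (subst nn_integral_cmult) auto
  also have "\<dots> = (\<integral>\<^sup>+\<omega>. ennreal (exp (a * Y \<omega> + (vX - c\<^sup>2 / vY) / 2)) * indicator A (Y \<omega>) \<partial>M)"
    by (intro nn_integral_cong)
      (simp add: mult.assoc[symmetric] ennreal_mult[symmetric] exp_add[symmetric] add.commute)
  finally show ?thesis by (simp only: vX_def vY_def c_def)
qed

end

text \<open>The finite index set is existential, matching the quantification in
  \<open>jointly_gaussian\<close>. Closure rules then show that \<open>V t\<close>,
  \<open>\<Lambda>\<close> and their combinations are Gaussian without computing coefficients over
  pairs of asset and time.\<close>

definition lin_span :: "'i set \<Rightarrow> ('i \<Rightarrow> 'a \<Rightarrow> real) \<Rightarrow> ('a \<Rightarrow> real) set" where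
  "lin_span I X = {Y. \<exists>F a. finite F \<and> F \<subseteq> I \<and> Y = (\<lambda>\<omega>. \<Sum>i\<in>F. a i * X i \<omega>)}"

lemma lin_span_base: "i \<in> I \<Longrightarrow> X i \<in> lin_span I X"
  unfolding lin_span_def by (auto intro!: exI[of _ "{i}"] exI[of _ "\<lambda>_. 1"])

lemma lin_span_scale:
  assumes "Y \<in> lin_span I X"
  shows "(\<lambda>\<omega>. c * Y \<omega>) \<in> lin_span I X"
proof -
  obtain F a where "finite F" "F \<subseteq> I" "Y = (\<lambda>\<omega>. \<Sum>i\<in>F. a i * X i \<omega>)"
    using assms by (auto simp: lin_span_def)
  then show ?thesis
    unfolding lin_span_def
    by (auto intro!: exI[of _ F] exI[of _ "\<lambda>i. c * a i"] simp: sum_distrib_left mult.assoc)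
qed

lemma lin_span_add:
  assumes "Y \<in> lin_span I X" "Z \<in> lin_span I X"
  shows "(\<lambda>\<omega>. Y \<omega> + Z \<omega>) \<in> lin_span I X"
proof -
  obtain F a where F: "finite F" "F \<subseteq> I" "Y = (\<lambda>\<omega>. \<Sum>i\<in>F. a i * X i \<omega>)"
    using assms by (auto simp: lin_span_def)
  obtain G b where G: "finite G" "G \<subseteq> I" "Z = (\<lambda>\<omega>. \<Sum>i\<in>G. b i * X i \<omega>)"
    using assms by (auto simp: lin_span_def)
  \<comment> \<open>Both coefficient families are extended by zero to the union, so indices common
    to \<open>F\<close> and \<open>G\<close> receive the sum of their coefficients.\<close>
  define c where "c i = (if i \<in> F then a i else 0) + (if i \<in> G then b i else 0)" for i
  have "Y \<omega> + Z \<omega> = (\<Sum>i\<in>F \<union> G. c i * X i \<omega>)" for \<omega>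
  proof -
    have "Y \<omega> = (\<Sum>i\<in>F \<union> G. (if i \<in> F then a i else 0) * X i \<omega>)"
      unfolding F(3) by (rule sum.mono_neutral_cong_left) (use F G in auto)
    moreover have "Z \<omega> = (\<Sum>i\<in>F \<union> G. (if i \<in> G then b i else 0) * X i \<omega>)"
      unfolding G(3) by (rule sum.mono_neutral_cong_left) (use F G in auto)
    ultimately show ?thesis by (simp add: c_def distrib_right sum.distrib)
  qed
  then show ?thesis
    unfolding lin_span_def using F(1,2) G(1,2) by (auto intro!: exI[of _ "F \<union> G"] exI[of _ c])
qed

lemma lin_span_sum:
  assumes "finite A" "\<And>k. k \<in> A \<Longrightarrow> Y k \<in> lin_span I X"
  shows "(\<lambda>\<omega>. \<Sum>k\<in>A. c k * Y k \<omega>) \<in> lin_span I X"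
  using assms
proof (induction A)
  case empty
  show ?case unfolding lin_span_def by (auto intro!: exI[of _ "{}"])
next
  case (insert k A)
  then show ?case by (simp add: lin_span_add lin_span_scale)
qed

context prob_space
begin

lemma centered_gaussian_integrable:
  assumes "centered_gaussian M X"
  shows "integrable M X"
proof -
  have [measurable]: "X \<in> borel_measurable M"
    using assms by (auto simp: centered_gaussian_def gaussian_rv_measurable)
  have "integrable M (\<lambda>\<omega>. 1 * X \<omega>)"
    by (rule integrable_mult_of_squares) (use centered_gaussian_square_integrable[OF assms] in auto)
  then show ?thesis by simp
qed

lemma centered_gaussian_lin_span:
  assumes joint: "jointly_gaussian M I X"
    and mean: "\<And>i. i \<in> I \<Longrightarrow> expectation (X i) = 0"
    and Y: "Y \<in> lin_span I X"
  shows "centered_gaussian M Y"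
proof -
  have X: "centered_gaussian M (X i)" if "i \<in> I" for i
    using joint[unfolded jointly_gaussian_def, rule_format, of "{i}" "\<lambda>_. 1"] that mean[OF that]
    by (simp add: centered_gaussian_def)
  obtain F a where F: "finite F" "F \<subseteq> I" and Y_eq: "Y = (\<lambda>\<omega>. \<Sum>i\<in>F. a i * X i \<omega>)"
    using Y by (auto simp: lin_span_def)
  have "expectation Y = (\<Sum>i\<in>F. a i * expectation (X i))"
    unfolding Y_eq using F X centered_gaussian_integrable by (subst Bochner_Integration.integral_sum) auto
  also have "\<dots> = 0" using F mean by (auto intro!: sum.neutral)
  finally show ?thesis
    using joint F unfolding centered_gaussian_def jointly_gaussian_def Y_eq by blast
qed

lemma expectation_sum_mult_sum:
  fixes X :: "'i \<Rightarrow> 'a \<Rightarrow> real" and Y :: "'j \<Rightarrow> 'a \<Rightarrow> real"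
  assumes "\<And>i j. i \<in> A \<Longrightarrow> j \<in> B \<Longrightarrow> integrable M (\<lambda>\<omega>. X i \<omega> * Y j \<omega>)"
  shows "expectation (\<lambda>\<omega>. (\<Sum>i\<in>A. a i * X i \<omega>) * (\<Sum>j\<in>B. b j * Y j \<omega>)) =
    (\<Sum>i\<in>A. \<Sum>j\<in>B. a i * b j * expectation (\<lambda>\<omega>. X i \<omega> * Y j \<omega>))"
proof -
  have "expectation (\<lambda>\<omega>. (\<Sum>i\<in>A. a i * X i \<omega>) * (\<Sum>j\<in>B. b j * Y j \<omega>)) =
      expectation (\<lambda>\<omega>. \<Sum>i\<in>A. \<Sum>j\<in>B. (a i * b j) * (X i \<omega> * Y j \<omega>))"
    by (simp add: sum_product mult_ac)
  also have "\<dots> = (\<Sum>i\<in>A. \<Sum>j\<in>B. expectation (\<lambda>\<omega>. (a i * b j) * (X i \<omega> * Y j \<omega>)))"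
    using assms by (subst Bochner_Integration.integral_sum; simp add: Bochner_Integration.integral_sum)
  finally show ?thesis by simp
qed

section \<open>Second moments of correlated Brownian motions\<close>

lemma brownian_mean:
  assumes B: "standard_brownian_motion M B" and t: "0 \<le> t"
  shows "expectation (B t) = 0"
proof -
  have [measurable]: "B t \<in> borel_measurable M" "B 0 \<in> borel_measurable M" and B0: "AE \<omega> in M. B 0 \<omega> = 0"
    using B t by (auto simp: standard_brownian_motion_def)
  show ?thesis
  \<comment> \<open>A law is prescribed only for increments over nonempty intervals, and
    \<open>B 0\<close> vanishes only almost surely; time 0 is therefore separate, and for other
    times \<open>B t\<close> is replaced by its increment from 0.\<close>
  proof (cases "t = 0")
    case True
    have "expectation (B 0) = expectation (\<lambda>_. 0)"
      by (intro integral_cong_AE) (use B0 in auto)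
    then show ?thesis by (simp add: True)
  next
    case False
    then have "distributed M lborel (\<lambda>\<omega>. B t \<omega> - B 0 \<omega>) (normal_density 0 (sqrt (t - 0)))"
      using B t unfolding standard_brownian_motion_def by (metis order.refl less_le)
    from normal_distributed_expectation[OF _ this]
    have "expectation (\<lambda>\<omega>. B t \<omega> - B 0 \<omega>) = 0" using False t by simp
    moreover have "expectation (\<lambda>\<omega>. B t \<omega> - B 0 \<omega>) = expectation (B t)"
      by (intro integral_cong_AE) (use B0 in auto)
    ultimately show ?thesis by simp
  qed
qed

text \<open>The covariance hypothesis always puts the later time in the second process. The opposite
  order needs symmetry of \<open>\<rho>\<close>, which follows by evaluating at the common time
  1.\<close>

lemma brownian_product_moment:
  assumes B: "\<And>j. standard_brownian_motion M (B j)"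
    and cov: "\<And>i j s t. s \<ge> 0 \<Longrightarrow> t \<ge> 0 \<Longrightarrow> covariance M (B i t) (B j (t + s)) = t * \<rho> $ i $ j"
    and "0 \<le> s" "0 \<le> t"
  shows "expectation (\<lambda>\<omega>. B i s \<omega> * B j t \<omega>) = min s t * \<rho> $ i $ j"
proof -
  have le: "expectation (\<lambda>\<omega>. B i s \<omega> * B j t \<omega>) = s * \<rho> $ i $ j" if "0 \<le> s" "s \<le> t" for i j s t
    using cov[of "t - s" s i j] that by (simp add: covariance_def brownian_mean[OF B])
  have "\<rho> $ i $ j = \<rho> $ j $ i"
    using le[of 1 1 i j] le[of 1 1 j i] by (simp add: mult.commute)
  then show ?thesis
    using le[of s t i j] le[of t s j i] assms by (cases "s \<le> t") (simp_all add: min_def mult.commute)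
qed

text \<open>For each pair of coordinates the four product moments combine to
  \<open>T - l - t + min t l\<close>, the length of the overlap of the intervals from
  \<open>t\<close> to \<open>T\<close> and from \<open>l\<close> to \<open>T\<close>.\<close>

lemma brownian_increment_moment:
  fixes y :: "real ^ 'm"
  assumes B: "\<And>j. standard_brownian_motion M (B j)"
    and joint: "jointly_gaussian M (UNIV \<times> {0..}) (\<lambda>(j, t). B j t)"
    and cov: "\<And>i j s t. s \<ge> 0 \<Longrightarrow> t \<ge> 0 \<Longrightarrow> covariance M (B i t) (B j (t + s)) = t * \<rho> $ i $ j"
    and t: "0 \<le> t" "t \<le> T" and l: "0 \<le> l" "l \<le> T"
  shows "expectation (\<lambda>\<omega>. (\<Sum>j\<in>UNIV. y $ j * (B j T \<omega> - B j t \<omega>)) * (\<Sum>j\<in>UNIV. y $ j * (B j T \<omega> - B j l \<omega>))) =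
    (\<Sum>i\<in>UNIV. \<Sum>j\<in>UNIV. y $ i * y $ j * \<rho> $ i $ j) * min (T - t) (T - l)"
proof -
  have cg: "centered_gaussian M (B j s)" if "0 \<le> s" for j s
    using centered_gaussian_lin_span[OF joint _ lin_span_base[of "(j, s)"]] that
    by (auto simp: brownian_mean[OF B])
  have int [simp]: "integrable M (\<lambda>\<omega>. B i s \<omega> * B j u \<omega>)" if "0 \<le> s" "0 \<le> u" for i j s u
    using cg that by (intro integrable_mult_of_squares centered_gaussian_square_integrable)
      (auto simp: centered_gaussian_def gaussian_rv_measurable)
  have int2: "integrable M (\<lambda>\<omega>. (B i T \<omega> - B i t \<omega>) * (B j T \<omega> - B j l \<omega>))" for i j
    using t l by (simp add: algebra_simps)
  have "expectation (\<lambda>\<omega>. (B i T \<omega> - B i t \<omega>) * (B j T \<omega> - B j l \<omega>)) = \<rho> $ i $ j * min (T - t) (T - l)" for i j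
  proof -
    have "expectation (\<lambda>\<omega>. (B i T \<omega> - B i t \<omega>) * (B j T \<omega> - B j l \<omega>)) =
      expectation (\<lambda>\<omega>. B i T \<omega> * B j T \<omega> - B i T \<omega> * B j l \<omega> - B i t \<omega> * B j T \<omega> + B i t \<omega> * B j l \<omega>)"
      by (simp add: algebra_simps)
    also have "\<dots> = min T T * \<rho> $ i $ j - min T l * \<rho> $ i $ j - min t T * \<rho> $ i $ j + min t l * \<rho> $ i $ j"
      using t l by (simp add: brownian_product_moment[OF B cov])
    also have "\<dots> = \<rho> $ i $ j * min (T - t) (T - l)"
      using t l by (auto simp: min_def algebra_simps)
    finally show ?thesis .
  qed
  then show ?thesis
    by (subst expectation_sum_mult_sum[OF int2]) (simp add: sum_distrib_right mult.assoc)
qed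

end

section \<open>Compound Poisson variables\<close>

lemma measurable_generated_sigma:
  assumes "\<And>i \<omega>. i \<in> I \<Longrightarrow> \<omega> \<in> space M \<Longrightarrow> X i \<omega> \<in> space K" "i \<in> I"
  shows "X i \<in> measurable (vimage_algebra (space M) (\<lambda>\<omega>. \<lambda>i\<in>I. X i \<omega>) (PiM I (\<lambda>_. K))) K"
proof -
  have "(\<lambda>\<omega>. \<lambda>i\<in>I. X i \<omega>) \<in> measurable (vimage_algebra (space M) (\<lambda>\<omega>. \<lambda>i\<in>I. X i \<omega>) (PiM I (\<lambda>_. K))) (PiM I (\<lambda>_. K))"
    by (rule measurable_vimage_algebra1) (use assms in \<open>auto simp: space_PiM\<close>)
  from measurable_compose[OF this measurable_component_singleton[OF assms(2)]]
  show ?thesis using assms(2) by (simp cong: measurable_cong)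
qed

text \<open>The generating function of the Poisson law, summed by the exponential series.\<close>

lemma nn_integral_poisson_power:
  assumes "0 < a" "0 \<le> m"
  shows "(\<integral>\<^sup>+k. ennreal m ^ k \<partial>measure_pmf (poisson_pmf a)) = ennreal (exp (a * (m - 1)))"
proof -
  have "(\<lambda>k. exp (- a) * ((a * m) ^ k /\<^sub>R fact k)) sums (exp (- a) * exp (a * m))"
    by (intro sums_mult exp_converges)
  then have s: "(\<lambda>k. a ^ k / fact k * exp (- a) * m ^ k) sums exp (a * (m - 1))"
    by (simp add: exp_add[symmetric] power_mult_distrib field_simps)
  have "(\<integral>\<^sup>+k. ennreal m ^ k \<partial>measure_pmf (poisson_pmf a)) = (\<Sum>k. ennreal (a ^ k / fact k * exp (- a) * m ^ k))"
    using assms by (simp add: nn_integral_measure_pmf nn_integral_count_space_nat ennreal_power ennreal_mult'[symmetric])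
  also have "\<dots> = ennreal (exp (a * (m - 1)))"
    by (rule suminf_ennreal_eq[OF _ s]) (use assms in auto)
  finally show ?thesis .
qed

context prob_space
begin

text \<open>Each \<open>X i\<close> generates a sub-algebra of \<open>F i\<close>. This turns the
  independence of the three source algebras into independence of whatever variables are read off
  from them.\<close>

lemma indep_vars_of_indep_sets:
  assumes indep: "indep_sets (\<lambda>i. sets (F i)) I"
    and space: "\<And>i. i \<in> I \<Longrightarrow> space (F i) = space M"
    and X: "\<And>i. i \<in> I \<Longrightarrow> X i \<in> measurable (F i) (K i)"
  shows "indep_vars K X I"
  unfolding indep_vars_def2
proof (intro conjI ballI)
  have sub: "sets (F i) \<subseteq> events" if "i \<in> I" for i
    using indep that by (auto simp: indep_sets_def)
  show "random_variable (K i) (X i)" if "i \<in> I" for i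
    using X[OF that] sub[OF that] space[OF that] by (auto simp: measurable_def)
  show "indep_sets (\<lambda>i. {X i -` A \<inter> space M |A. A \<in> sets (K i)}) I"
  proof (rule indep_sets_mono_sets[OF indep])
    fix i assume i: "i \<in> I"
    show "{X i -` A \<inter> space M |A. A \<in> sets (K i)} \<subseteq> sets (F i)"
      using measurable_sets[OF X[OF i]] space[OF i] by auto
  qed
qed

text \<open>Conditioning on the countably many values of \<open>P\<close>, without a product space: the three
  factors have different target spaces, so their independence is given on the level of
  \<open>\<sigma>\<close>-algebras.\<close>

lemma nn_integral_independent_index:
  fixes P :: "'a \<Rightarrow> 'p::countable" and G :: "'p \<Rightarrow> 'a \<Rightarrow> ennreal" and Q :: "'a \<Rightarrow> ennreal"
  assumes indep: "indep_sets (\<lambda>i. [sets F0, sets F1, sets F2] ! i) {..<3}"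
    and space: "space F0 = space M" "space F1 = space M" "space F2 = space M"
    and Q: "Q \<in> borel_measurable F0"
    and P: "P \<in> measurable F1 (count_space UNIV)"
    and G: "\<And>p. G p \<in> borel_measurable F2"
  shows "(\<integral>\<^sup>+\<omega>. G (P \<omega>) \<omega> * Q \<omega> \<partial>M) =
    (\<integral>\<^sup>+\<omega>. (\<integral>\<^sup>+\<omega>'. G (P \<omega>) \<omega>' \<partial>M) \<partial>M) * (\<integral>\<^sup>+\<omega>. Q \<omega> \<partial>M)"
proof -
  have three: "{..<3} = {0, 1, 2::nat}" by auto
  have ev: "sets F0 \<subseteq> events" "sets F1 \<subseteq> events" "sets F2 \<subseteq> events"
    using indep by (auto simp: indep_sets_def three)
  have [measurable]: "Q \<in> borel_measurable M" "G p \<in> borel_measurable M" "P \<in> measurable M (count_space UNIV)" for p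
    using Q P G[of p] ev space by (auto simp: measurable_def)
  \<comment> \<open>Events are indexed through \<open>to_nat\<close>, so that the decomposition over
    values of \<open>P\<close> becomes a series over the naturals; numbers that encode no value
    contribute an indicator equal to zero.\<close>
  let ?one = "\<lambda>n \<omega>. indicator {n} (to_nat (P \<omega>)) :: ennreal"
  have fact: "(\<integral>\<^sup>+\<omega>. ?one n \<omega> * (G p \<omega> * Q \<omega>) \<partial>M) =
      (\<integral>\<^sup>+\<omega>. ?one n \<omega> \<partial>M) * (\<integral>\<^sup>+\<omega>. G p \<omega> \<partial>M) * (\<integral>\<^sup>+\<omega>. Q \<omega> \<partial>M)" for n p
  proof -
    have "indep_vars (\<lambda>_. borel) (\<lambda>i. [Q, ?one n, G p] ! i) {..<3::nat}"
    proof (rule indep_vars_of_indep_sets[where F = "\<lambda>i. [F0, F1, F2] ! i"])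
      show "indep_sets (\<lambda>i. sets ([F0, F1, F2] ! i)) {..<3}"
        by (rule indep_sets_cong[THEN iffD1, OF refl _ indep]) (auto simp: three)
      have "?one n \<in> borel_measurable F1" using P by measurable
      then show "[Q, ?one n, G p] ! i \<in> borel_measurable ([F0, F1, F2] ! i)" if "i \<in> {..<3}" for i
        using that Q G by (auto simp: three)
    qed (auto simp: three space)
    from indep_vars_nn_integral[OF _ this]
    show ?thesis by (simp add: three mult_ac)
  qed
  have expand: "H (P \<omega>) = (\<Sum>n. indicator {n} (to_nat (P \<omega>)) * H (from_nat n))" for H :: "'p \<Rightarrow> ennreal" and \<omega>
  proof -
    have "(\<lambda>n. if n = to_nat (P \<omega>) then H (from_nat n) else 0) sums H (from_nat (to_nat (P \<omega>)))"
      by (rule sums_single)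
    moreover have "(\<lambda>n. if n = to_nat (P \<omega>) then H (from_nat n) else 0) =
        (\<lambda>n. indicator {n} (to_nat (P \<omega>)) * H (from_nat n))"
      by (auto simp: indicator_def)
    ultimately show ?thesis by (simp add: sums_iff)
  qed
  define f where "f = (\<lambda>p. \<integral>\<^sup>+\<omega>. G p \<omega> \<partial>M)"
  have "(\<integral>\<^sup>+\<omega>. G (P \<omega>) \<omega> * Q \<omega> \<partial>M) =
      (\<integral>\<^sup>+\<omega>. (\<Sum>n. ?one n \<omega> * (G (from_nat n) \<omega> * Q \<omega>)) \<partial>M)"
    by (subst expand[of "\<lambda>p. G p _ * Q _"]) simp
  also have "\<dots> = (\<Sum>n. (\<integral>\<^sup>+\<omega>. ?one n \<omega> \<partial>M) * f (from_nat n) * (\<integral>\<^sup>+\<omega>. Q \<omega> \<partial>M))"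
    by (subst nn_integral_suminf) (simp_all add: fact f_def)
  also have "\<dots> = (\<Sum>n. (\<integral>\<^sup>+\<omega>. ?one n \<omega> * f (from_nat n) \<partial>M)) * (\<integral>\<^sup>+\<omega>. Q \<omega> \<partial>M)"
    by (simp add: nn_integral_multc)
  also have "(\<Sum>n. (\<integral>\<^sup>+\<omega>. ?one n \<omega> * f (from_nat n) \<partial>M)) = (\<integral>\<^sup>+\<omega>. f (P \<omega>) \<partial>M)"
    unfolding expand[of f] by (subst nn_integral_suminf) simp_all
  finally show ?thesis by (simp only: f_def)
qed

end

context prob_space
begin

text \<open>Injectivity of \<open>g\<close> ensures that distinct pairs use distinct independent
  variables, so the nested product is one product over a finite subset of \<open>I\<close>. The map
  \<open>g\<close> reconciles the order of the indices: it will be \<open>prod.swap\<close>.\<close>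

lemma nn_integral_prod_Sigma:
  fixes X :: "'i \<Rightarrow> 'a \<Rightarrow> ennreal"
  assumes indep: "indep_vars (\<lambda>_. borel) X I"
    and fin: "finite A" "\<And>r. r \<in> A \<Longrightarrow> finite (K r)"
    and g: "inj_on g (Sigma A K)" "g ` Sigma A K \<subseteq> I"
    and m: "\<And>r k. r \<in> A \<Longrightarrow> k \<in> K r \<Longrightarrow> (\<integral>\<^sup>+\<omega>. X (g (r, k)) \<omega> \<partial>M) = m r"
  shows "(\<integral>\<^sup>+\<omega>. (\<Prod>r\<in>A. \<Prod>k\<in>K r. X (g (r, k)) \<omega>) \<partial>M) = (\<Prod>r\<in>A. m r ^ card (K r))"
proof -
  have S: "(\<Prod>r\<in>A. \<Prod>k\<in>K r. h (g (r, k))) = (\<Prod>i\<in>g ` Sigma A K. h i)" for h :: "'i \<Rightarrow> ennreal"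
    using fin by (simp add: prod.Sigma prod.reindex[OF g(1)] case_prod_unfold)
  have "(\<integral>\<^sup>+\<omega>. (\<Prod>r\<in>A. \<Prod>k\<in>K r. X (g (r, k)) \<omega>) \<partial>M) = (\<integral>\<^sup>+\<omega>. (\<Prod>i\<in>g ` Sigma A K. X i \<omega>) \<partial>M)"
    by (simp only: S[of "\<lambda>i. X i _"])
  also have "\<dots> = (\<Prod>i\<in>g ` Sigma A K. \<integral>\<^sup>+\<omega>. X i \<omega> \<partial>M)"
    by (rule indep_vars_nn_integral) (use fin indep_vars_subset[OF indep g(2)] in auto)
  also have "\<dots> = (\<Prod>r\<in>A. \<Prod>k\<in>K r. \<integral>\<^sup>+\<omega>. X (g (r, k)) \<omega> \<partial>M)"
    by (rule S[symmetric])
  finally show ?thesis by (simp add: m)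
qed

text \<open>Here \<open>r\<close> ranges over streams of jumps, and \<open>s r\<close> is the
  counting process that clocks stream \<open>r\<close>. Streams with the same clock share a jump
  count, so their means multiply inside a single Poisson generating function; different clocks
  contribute independent factors. The variable \<open>Q\<close> carries the part independent of the
  jumps.\<close>

lemma compound_poisson_transform:
  fixes a b :: "'c::finite \<Rightarrow> 'a \<Rightarrow> nat" and U :: "nat \<Rightarrow> 'r \<Rightarrow> 'a \<Rightarrow> real"
    and s :: "'r \<Rightarrow> 'c" and Q :: "'a \<Rightarrow> ennreal"
  assumes A: "finite A" and indep: "indep_sets (\<lambda>i. [sets F0, sets F1, sets F2] ! i) {..<3}"
    and space: "space F0 = space M" "space F1 = space M" "space F2 = space M"
    and Q: "Q \<in> borel_measurable F0"
    and a: "\<And>c. a c \<in> measurable F1 (count_space UNIV)"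
    and b: "\<And>c. b c \<in> measurable F1 (count_space UNIV)"
    and U: "\<And>k r. k \<ge> 1 \<Longrightarrow> r \<in> A \<Longrightarrow> U k r \<in> borel_measurable F2"
    and count_indep: "indep_vars (\<lambda>_. count_space UNIV) (\<lambda>c \<omega>. b c \<omega> - a c \<omega>) UNIV"
    and rate: "\<And>c. 0 < rate c"
    and count_distr: "\<And>c. distr M (count_space UNIV) (\<lambda>\<omega>. b c \<omega> - a c \<omega>) = measure_pmf (poisson_pmf (rate c))"
    and U_indep: "indep_vars (\<lambda>_. borel) (\<lambda>(k, r). U k r) ({1..} \<times> A)"
    and U_mean: "\<And>k r. k \<ge> 1 \<Longrightarrow> r \<in> A \<Longrightarrow> (\<integral>\<^sup>+\<omega>. ennreal (U k r \<omega>) \<partial>M) = ennreal (m r)"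
    and m_nonneg: "\<And>r. r \<in> A \<Longrightarrow> 0 \<le> m r"
  shows "(\<integral>\<^sup>+\<omega>. (\<Prod>r\<in>A. \<Prod>k = a (s r) \<omega> + 1..b (s r) \<omega>. ennreal (U k r \<omega>)) * Q \<omega> \<partial>M) =
    ennreal (exp (\<Sum>c\<in>UNIV. rate c * ((\<Prod>r\<in>{r \<in> A. s r = c}. m r) - 1))) * (\<integral>\<^sup>+\<omega>. Q \<omega> \<partial>M)"
proof -
  \<comment> \<open>The set of jump indices depends on both endpoints, not only on the count, so
    conditioning must fix both. As there are finitely many clocks, these data take countably many
    values.\<close>
  define P where "P = (\<lambda>\<omega> c. (a c \<omega>, b c \<omega>))"
  define G where "G = (\<lambda>p \<omega>. \<Prod>r\<in>A. \<Prod>k = fst (p (s r)) + 1..snd (p (s r)). ennreal (U k r \<omega>))"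
  have ev: "sets F1 \<subseteq> events"
    using indep unfolding indep_sets_def by (auto dest!: bspec[of _ _ 1])
  have [measurable]: "a c \<in> measurable M (count_space UNIV)" "b c \<in> measurable M (count_space UNIV)" for c
    using a[of c] b[of c] ev space by (auto simp: measurable_def)
  have P_meas: "P \<in> measurable F1 (count_space UNIV)"
  proof (rule measurable_count_space_eq2_countable[THEN iffD2])
    show "P \<in> space F1 \<rightarrow> UNIV \<and> (\<forall>p\<in>UNIV. P -` {p} \<inter> space F1 \<in> sets F1)"
    proof (intro conjI ballI)
      fix p :: "'c \<Rightarrow> nat \<times> nat"
      have "P -` {p} \<inter> space F1 = {\<omega> \<in> space F1. \<forall>c\<in>UNIV. a c \<omega> = fst (p c) \<and> b c \<omega> = snd (p c)}"
        by (auto simp: P_def fun_eq_iff prod_eq_iff)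
      also have "\<dots> \<in> sets F1"
        using a b by measurable
      finally show "P -` {p} \<inter> space F1 \<in> sets F1" .
    qed simp
  qed
  have G_meas: "G p \<in> borel_measurable F2" for p
    unfolding G_def by (intro borel_measurable_prod_ennreal measurable_compose[OF U]) auto
  \<comment> \<open>With the endpoints frozen, only the number of jumps matters. Truncated
    subtraction is the cardinality of the index range, also when that range is empty.\<close>
  have G_mean: "(\<integral>\<^sup>+\<omega>. G p \<omega> \<partial>M) = (\<Prod>r\<in>A. ennreal (m r) ^ (snd (p (s r)) - fst (p (s r))))" for p
  proof -
    have "indep_vars (\<lambda>_. borel) (\<lambda>i \<omega>. ennreal (case i of (k, r) \<Rightarrow> U k r \<omega>)) ({1..} \<times> A)"
      using indep_vars_compose2[OF U_indep, of "\<lambda>_. ennreal" "\<lambda>_. borel"] by (simp add: case_prod_unfold)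
    moreover have "prod.swap ` (SIGMA r:A. {fst (p (s r)) + 1..snd (p (s r))}) \<subseteq> {1..} \<times> A"
      by auto
    ultimately show ?thesis unfolding G_def using A nn_integral_prod_Sigma[where X = "\<lambda>i \<omega>. ennreal (case i of (k, r) \<Rightarrow> U k r \<omega>)" and I = "{1..} \<times> A" and A = A and g = prod.swap and m = "\<lambda>r. ennreal (m r)"
        and K = "\<lambda>r. {fst (p (s r)) + 1..snd (p (s r))}"]
      by (simp add: U_mean cong: prod.cong)
  qed
  have group: "(\<Prod>r\<in>A. ennreal (m r) ^ n (s r)) = (\<Prod>c\<in>UNIV. ennreal (\<Prod>r\<in>{r \<in> A. s r = c}. m r) ^ n c)"
    for n :: "'c \<Rightarrow> nat"
  proof -
    have "(\<Prod>r\<in>A. ennreal (m r) ^ n (s r)) = (\<Prod>c\<in>UNIV. \<Prod>r\<in>{r \<in> A. s r = c}. ennreal (m r) ^ n (s r))"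
      by (rule prod.group[symmetric]) (use A in auto)
    also have "\<dots> = (\<Prod>c\<in>UNIV. ennreal (\<Prod>r\<in>{r \<in> A. s r = c}. m r) ^ n c)"
      by (intro prod.cong refl, subst prod_ennreal[symmetric]) (auto simp: m_nonneg prod_power_distrib)
    finally show ?thesis .
  qed
  have "(\<integral>\<^sup>+\<omega>. G (P \<omega>) \<omega> * Q \<omega> \<partial>M) = (\<integral>\<^sup>+\<omega>. (\<integral>\<^sup>+\<omega>'. G (P \<omega>) \<omega>' \<partial>M) \<partial>M) * (\<integral>\<^sup>+\<omega>. Q \<omega> \<partial>M)"
    by (rule nn_integral_independent_index[OF indep space Q P_meas G_meas])
  also have "(\<integral>\<^sup>+\<omega>. (\<integral>\<^sup>+\<omega>'. G (P \<omega>) \<omega>' \<partial>M) \<partial>M) =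
      (\<integral>\<^sup>+\<omega>. (\<Prod>c\<in>UNIV. ennreal (\<Prod>r\<in>{r \<in> A. s r = c}. m r) ^ (b c \<omega> - a c \<omega>)) \<partial>M)"
    unfolding G_mean by (simp add: P_def group[of "\<lambda>c. b c _ - a c _"])
  also have "\<dots> = (\<Prod>c\<in>UNIV. \<integral>\<^sup>+\<omega>. ennreal (\<Prod>r\<in>{r \<in> A. s r = c}. m r) ^ (b c \<omega> - a c \<omega>) \<partial>M)"
    by (rule indep_vars_nn_integral)
      (auto intro!: indep_vars_compose2[OF count_indep, where Y = "\<lambda>c n. ennreal (\<Prod>r\<in>{r \<in> A. s r = c}. m r) ^ n"])
  also have "\<dots> = (\<Prod>c\<in>UNIV. ennreal (exp (rate c * ((\<Prod>r\<in>{r \<in> A. s r = c}. m r) - 1))))"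
  proof (intro prod.cong refl)
    fix c
    let ?m = "\<Prod>r\<in>{r \<in> A. s r = c}. m r"
    have "(\<integral>\<^sup>+\<omega>. ennreal ?m ^ (b c \<omega> - a c \<omega>) \<partial>M) =
        (\<integral>\<^sup>+n. ennreal ?m ^ n \<partial>distr M (count_space UNIV) (\<lambda>\<omega>. b c \<omega> - a c \<omega>))"
      by (subst nn_integral_distr) auto
    also have "\<dots> = ennreal (exp (rate c * (?m - 1)))"
      unfolding count_distr by (rule nn_integral_poisson_power) (auto simp: rate m_nonneg intro!: prod_nonneg)
    finally show "(\<integral>\<^sup>+\<omega>. ennreal ?m ^ (b c \<omega> - a c \<omega>) \<partial>M) = ennreal (exp (rate c * (?m - 1)))" .
  qed
  also have "\<dots> = ennreal (exp (\<Sum>c\<in>UNIV. rate c * ((\<Prod>r\<in>{r \<in> A. s r = c}. m r) - 1)))"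
    by (simp add: prod_ennreal exp_sum)
  finally show ?thesis by (simp add: G_def P_def)
qed

end

section \<open>Comonotonic lower bound\<close>

text \<open>The events generated by \<open>\<Lambda>\<close> are exactly the preimages of Borel
  sets, so these tests suffice, and \<open>\<phi>\<close> makes \<open>g\<close> measurable for that
  algebra. Integrability of \<open>g\<close> comes from that of \<open>f\<close> by testing with the
  whole line.\<close>

lemma (in prob_space) cond_exp_rv_charact:
  fixes f g :: "'a \<Rightarrow> real" and \<Lambda> :: "'a \<Rightarrow> real"
  assumes [measurable]: "\<Lambda> \<in> borel_measurable M" "f \<in> borel_measurable M" "\<phi> \<in> borel_measurable borel"
    and g: "g = (\<lambda>\<omega>. \<phi> (\<Lambda> \<omega>))"
    and nonneg: "\<And>\<omega>. 0 \<le> f \<omega>" "\<And>\<omega>. 0 \<le> g \<omega>"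
    and fin: "(\<integral>\<^sup>+\<omega>. ennreal (f \<omega>) \<partial>M) < \<infinity>"
    and eq: "\<And>A. A \<in> sets borel \<Longrightarrow> (\<integral>\<^sup>+\<omega>. ennreal (f \<omega>) * indicator A (\<Lambda> \<omega>) \<partial>M) =
      (\<integral>\<^sup>+\<omega>. ennreal (g \<omega>) * indicator A (\<Lambda> \<omega>) \<partial>M)"
  shows "AE \<omega> in M. cond_exp_rv M f \<Lambda> \<omega> = g \<omega>"
proof -
  let ?F = "vimage_algebra (space M) \<Lambda> borel"
  have sets_F: "sets ?F = {\<Lambda> -` A \<inter> space M |A. A \<in> sets borel}"
    by (rule sets_vimage_algebra2) simp
  have "subalgebra M ?F"
    by (auto simp: subalgebra_def sets_F)
  then interpret finite_measure_subalgebra M ?F by unfold_locales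
  have [measurable]: "g \<in> borel_measurable M" unfolding g by measurable
  have \<Lambda>_F: "\<Lambda> \<in> borel_measurable ?F" by (rule measurable_vimage_algebra1) simp
  have f_int: "integrable M f"
    by (rule integrableI_nonneg) (use nonneg fin in auto)
  have "(\<integral>\<^sup>+\<omega>. ennreal (g \<omega>) \<partial>M) = (\<integral>\<^sup>+\<omega>. ennreal (f \<omega>) \<partial>M)"
    using eq[of UNIV] by simp
  then have g_int: "integrable M g"
    by (intro integrableI_nonneg) (use nonneg fin in auto)
  show ?thesis
    unfolding cond_exp_rv_def
  proof (rule real_cond_exp_charact[OF _ f_int g_int])
    show "g \<in> borel_measurable ?F"
      unfolding g by (rule measurable_compose[OF \<Lambda>_F]) simp
    fix S assume "S \<in> sets ?F"
    then obtain A where A [measurable]: "A \<in> sets borel" and S: "S = \<Lambda> -` A \<inter> space M"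
      by (auto simp: sets_F)
    have set_int: "(\<integral>\<omega>\<in>S. h \<omega> \<partial>M) = enn2real (\<integral>\<^sup>+\<omega>. ennreal (h \<omega>) * indicator A (\<Lambda> \<omega>) \<partial>M)"
      if [measurable]: "h \<in> borel_measurable M" and h: "\<And>\<omega>. 0 \<le> h \<omega>" for h
    proof -
      have "(\<integral>\<omega>\<in>S. h \<omega> \<partial>M) = (\<integral>\<omega>. h \<omega> * indicator A (\<Lambda> \<omega>) \<partial>M)"
        unfolding set_lebesgue_integral_def S
        by (intro Bochner_Integration.integral_cong) (auto simp: indicator_def)
      also have "\<dots> = enn2real (\<integral>\<^sup>+\<omega>. ennreal (h \<omega> * indicator A (\<Lambda> \<omega>)) \<partial>M)"
        by (rule integral_eq_nn_integral) (use h in auto)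
      also have "(\<lambda>\<omega>. ennreal (h \<omega> * indicator A (\<Lambda> \<omega>))) = (\<lambda>\<omega>. ennreal (h \<omega>) * indicator A (\<Lambda> \<omega>))"
        by (auto simp: indicator_def)
      finally show ?thesis .
    qed
    show "(\<integral>\<omega>\<in>S. f \<omega> \<partial>M) = (\<integral>\<omega>\<in>S. g \<omega> \<partial>M)"
      by (simp add: set_int nonneg eq[OF A])
  qed
qed

theorem theorem2p2:
  fixes M :: "'a measure"
    and r lam :: real and \<tau> :: nat and \<alpha> :: "nat \<Rightarrow> real"
    and \<sigma> \<mu> lams x :: "real ^ 'm" and \<rho> :: "real ^ 'm ^ 'm"
    and B' :: "'m \<Rightarrow> real \<Rightarrow> 'a \<Rightarrow> real"
    and N :: "real \<Rightarrow> 'a \<Rightarrow> nat" and Ns :: "'m \<Rightarrow> real \<Rightarrow> 'a \<Rightarrow> nat"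
    and Z Zstar :: "nat \<Rightarrow> 'm \<Rightarrow> nat \<Rightarrow> 'a \<Rightarrow> real"
    and h :: "'m \<Rightarrow> nat \<Rightarrow> real" and \<mu>vec :: "real ^ 'm" and \<Sigma> :: "real ^ 'm ^ 'm" and \<mu>x q :: real
    and Bx :: "real \<Rightarrow> 'a \<Rightarrow> real" and S V X :: "nat \<Rightarrow> 'a \<Rightarrow> real" and W \<Lambda> WL :: "'a \<Rightarrow> real"
    and c2 c3 c4 :: "nat \<Rightarrow> real"
  assumes h_def: "h = (\<lambda>j l. prob_space.expectation M (\<lambda>\<omega>. exp (Z 1 j l \<omega>)) - 1)"
    and \<mu>vec_def: "\<mu>vec = (\<chi> j. r + \<mu> $ j - lam * h j 0 - lams $ j * h j 1)"
    and \<mu>x_def: "\<mu>x = (\<mu>vec - r *\<^sub>R 1) \<bullet> x + r"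
    and \<Sigma>_def: "\<Sigma> = (\<chi> i j. \<sigma> $ i * \<sigma> $ j * \<rho> $ i $ j)"
    and q_def: "q = x \<bullet> (\<Sigma> *v x)"
    and Bx_def: "Bx = (\<lambda>t \<omega>. 1 / q * (\<Sum>j\<in>UNIV. x $ j * \<sigma> $ j * B' j t \<omega>))"
    and S_def: "S = (\<lambda>(t :: nat) \<omega>. (real \<tau> - real t) * (\<mu>x - q / 2)
      + (\<Sum>j\<in>UNIV. \<Sum>k = N (real t) \<omega> + 1..N (real \<tau>) \<omega>. Zstar k j 0 \<omega>)
      + (\<Sum>j\<in>UNIV. \<Sum>k = Ns j (real t) \<omega> + 1..Ns j (real \<tau>) \<omega>. Zstar k j 1 \<omega>))"
    and V_def: "V = (\<lambda>(t :: nat) \<omega>. q * (Bx (real \<tau>) \<omega> - Bx (real t) \<omega>))"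
    and X_def: "X = (\<lambda>t \<omega>. \<alpha> t * exp (S t \<omega> + V t \<omega>))"
    and W_def: "W = (\<lambda>\<omega>. \<Sum>t<\<tau>. X t \<omega>)"
    and \<Lambda>_def: "\<Lambda> = (\<lambda>\<omega>. \<Sum>t<\<tau>. \<alpha> t * V t \<omega>)"
    and WL_def: "WL = comonotonic_lower_bound M \<tau> X \<Lambda>"
    and c2_def: "c2 = (\<lambda>(t :: nat). (real \<tau> - real t) * r
      + lam * (real \<tau> - real t) * ((\<Prod>j\<in>UNIV. mgf M (Zstar 1 j 0) 1) - 1)
      + (\<Sum>j\<in>UNIV. lams $ j * (real \<tau> - real t) * (mgf M (Zstar 1 j 1) 1 - 1)))"
    and c3_def: "c3 = (\<lambda>(t :: nat). (real \<tau> - real t) * ((\<mu>vec - r *\<^sub>R 1) \<bullet> x)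
      - 1 / 2 * q * (\<Sum>l<\<tau>. \<alpha> l * min (real \<tau> - real t) (real \<tau> - real l))\<^sup>2
        / (\<Sum>k<\<tau>. \<Sum>l<\<tau>. \<alpha> k * \<alpha> l * min (real \<tau> - real k) (real \<tau> - real l)))"
    and c4_def: "c4 = (\<lambda>(t :: nat). (\<Sum>l<\<tau>. \<alpha> l * min (real \<tau> - real t) (real \<tau> - real l))
        / sqrt (\<Sum>k<\<tau>. \<Sum>l<\<tau>. \<alpha> k * \<alpha> l * min (real \<tau> - real k) (real \<tau> - real l)))"
    and prob_space: "prob_space M"
    and r_pos: "r > 0"
    and \<tau>_pos: "\<tau> > 0"
    and \<alpha>_nonneg: "\<And>t. t < \<tau> \<Longrightarrow> \<alpha> t \<ge> 0"
    and \<alpha>_nonzero: "\<exists>t<\<tau>. \<alpha> t \<noteq> 0"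
    and \<sigma>_pos: "\<And>j. \<sigma> $ j > 0"
    and q_pos: "q > 0"
    and brownian: "\<And>j. standard_brownian_motion M (B' j)"
    and brownian_gaussian: "jointly_gaussian M (UNIV \<times> {0..}) (\<lambda>(j, t). B' j t)"
    and brownian_cov:
      "\<And>i j s t. s \<ge> 0 \<Longrightarrow> t \<ge> 0 \<Longrightarrow> covariance M (B' i t) (B' j (t + s)) = t * \<rho> $ i $ j"
    and poisson_common: "poisson_process M lam N"
    and poisson_single: "\<And>j. poisson_process M (lams $ j) (Ns j)"
    and poisson_indep:
      "prob_space.indep_vars M (\<lambda>_. PiM {0..} (\<lambda>_. count_space UNIV))
         (\<lambda>i \<omega>. \<lambda>t\<in>{0..}. case_option N Ns i t \<omega>) UNIV"
    and Z_continuous: "\<And>k j l. k \<ge> 1 \<Longrightarrow> l \<in> {0, 1} \<Longrightarrow> continuous_rv M (Z k j l)"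
    and Z_identical:
      "\<And>k j l. k \<ge> 1 \<Longrightarrow> l \<in> {0, 1} \<Longrightarrow> distr M borel (Z k j l) = distr M borel (Z 1 j 0)"
    and Z_indep:
      "prob_space.indep_vars M (\<lambda>_. borel) (\<lambda>(k, j, l). Z k j l) ({1..} \<times> UNIV \<times> {0, 1})"
    and Z_exp_integrable:
      "\<And>k j l. k \<ge> 1 \<Longrightarrow> l \<in> {0, 1} \<Longrightarrow> integrable M (\<lambda>\<omega>. exp (Z k j l \<omega>))"
    and families_indep:
      "prob_space.indep_sets M
         (\<lambda>i. [generated_sigma M borel (UNIV \<times> {0..}) (\<lambda>(j, t). B' j t),
               generated_sigma M (count_space UNIV) (UNIV \<times> {0..}) (\<lambda>(i, t). case_option N Ns i t),
               generated_sigma M borel ({1..} \<times> UNIV \<times> {0, 1}) (\<lambda>(k, j, l). Z k j l)] ! i)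
         {..<3}"
    and Zstar_measurable:
      "\<And>k j l. k \<ge> 1 \<Longrightarrow> l \<in> {0, 1} \<Longrightarrow> Zstar k j l \<in> borel_measurable M"
    and Zstar:
      "\<And>k j l. k \<ge> 1 \<Longrightarrow> l \<in> {0, 1} \<Longrightarrow>
         AE \<omega> in M. exp (Zstar k j l \<omega>) - 1 = x $ j * (exp (Z k j l \<omega>) - 1)"
  shows "AE \<omega> in M. WL \<omega> =
      (\<Sum>t<\<tau>. \<alpha> t * exp (\<Lambda> \<omega> / std_dev M \<Lambda> * sqrt q * c4 t + c3 t + c2 t))"
proof -
  interpret prob_space M by (rule prob_space)

  \<comment> \<open>The three independent sources of randomness\<close>
  define F0 where "F0 = vimage_algebra (space M) (\<lambda>\<omega>. \<lambda>i\<in>UNIV \<times> {0..}. (case i of (j, t) \<Rightarrow> B' j t) \<omega>) (PiM (UNIV \<times> {0..}) (\<lambda>_. borel))"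
  define F1 where "F1 = vimage_algebra (space M) (\<lambda>\<omega>. \<lambda>i\<in>UNIV \<times> {0..}. (case i of (c, t) \<Rightarrow> case_option N Ns c t) \<omega>) (PiM (UNIV \<times> {0..}) (\<lambda>_. count_space UNIV))"
  define F2 where "F2 = vimage_algebra (space M) (\<lambda>\<omega>. \<lambda>i\<in>{1..} \<times> UNIV \<times> {0, 1}. (case i of (k, j, l) \<Rightarrow> Z k j l) \<omega>) (PiM ({1..} \<times> UNIV \<times> {0, 1}) (\<lambda>_. borel))"
  have indep: "indep_sets (\<lambda>i. [sets F0, sets F1, sets F2] ! i) {..<3}"
    using families_indep by (simp only: generated_sigma_def F0_def F1_def F2_def)
  have space: "space F0 = space M" "space F1 = space M" "space F2 = space M"
    by (simp_all add: F0_def F1_def F2_def)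
  have B_F0 [measurable]: "B' j t \<in> borel_measurable F0" if "0 \<le> t" for j t
    using measurable_generated_sigma[of "UNIV \<times> {0..}" M "\<lambda>(j, t). B' j t" borel "(j, t)"] that
    by (simp add: F0_def)
  have N_F1: "case_option N Ns c t \<in> measurable F1 (count_space UNIV)" if "0 \<le> t" for c t
    using measurable_generated_sigma[of "UNIV \<times> {0..}" M "\<lambda>(c, t). case_option N Ns c t" "count_space UNIV" "(c, t)"] that
    by (simp add: F1_def)
  have Z_F2: "Z k j l \<in> borel_measurable F2" if "k \<ge> 1" "l \<in> {0, 1}" for k j l
    using measurable_generated_sigma[of "{1..} \<times> UNIV \<times> {0, 1}" M "\<lambda>(k, j, l). Z k j l" borel "(k, j, l)"] that
    by (auto simp: F2_def)

  \<comment> \<open>Covariances of the Gaussian part\<close>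
  define y where "y = (\<chi> j. x $ j * \<sigma> $ j)"
  \<comment> \<open>The factor \<open>q\<close> in \<open>V\<close> cancels the normalisation
    \<open>1 / q\<close> in \<open>Bx\<close>; the weights \<open>y\<close> absorb the volatilities,
    so that \<open>q\<close> is their quadratic form in \<open>\<rho>\<close>.\<close>
  have V: "V t = (\<lambda>\<omega>. \<Sum>j\<in>UNIV. y $ j * (B' j (real \<tau>) \<omega> - B' j (real t) \<omega>))" for t
    using q_pos by (simp add: V_def Bx_def y_def right_diff_distrib sum_subtractf)
  have q: "q = (\<Sum>i\<in>UNIV. \<Sum>j\<in>UNIV. y $ i * y $ j * \<rho> $ i $ j)"
    by (simp add: q_def \<Sigma>_def y_def inner_vec_def matrix_vector_mult_def sum_distrib_left mult_ac)
  let ?L = "lin_span (UNIV \<times> {0..}) (\<lambda>(j, t). B' j t)"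
  have gauss: "centered_gaussian M Y" if "Y \<in> ?L" for Y
    by (rule centered_gaussian_lin_span[OF brownian_gaussian _ that]) (auto simp: brownian_mean[OF brownian])
  have V_span: "V t \<in> ?L" for t
  proof -
    have B: "B' j s \<in> ?L" if "0 \<le> s" for j s
      using lin_span_base[of "(j, s)" "UNIV \<times> {0..}" "\<lambda>(j, t). B' j t"] that by simp
    have "(\<lambda>\<omega>. B' j (real \<tau>) \<omega> + (- 1) * B' j (real t) \<omega>) \<in> ?L" for j
      by (intro lin_span_add lin_span_scale B) auto
    then show ?thesis unfolding V by (intro lin_span_sum) auto
  qed
  have \<Lambda>_span: "\<Lambda> \<in> ?L"
    unfolding \<Lambda>_def by (intro lin_span_sum V_span) auto
  have [measurable]: "V t \<in> borel_measurable F0" for t unfolding V by measurable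
  have [measurable]: "\<Lambda> \<in> borel_measurable F0" unfolding \<Lambda>_def by measurable
  have [measurable]: "V t \<in> borel_measurable M" "\<Lambda> \<in> borel_measurable M" for t
    using gauss[OF V_span[of t]] gauss[OF \<Lambda>_span] by (auto simp: centered_gaussian_def gaussian_rv_measurable)
  have int [simp]: "integrable M (\<lambda>\<omega>. X \<omega> * Y \<omega>)" if "X \<in> ?L" "Y \<in> ?L" for X Y
    using gauss[OF that(1)] gauss[OF that(2)]
    by (intro integrable_mult_of_squares centered_gaussian_square_integrable)
      (auto simp: centered_gaussian_def gaussian_rv_measurable)

  \<comment> \<open>Up to the factor \<open>q\<close>, \<open>A t\<close> is the covariance of
    \<open>V t\<close> with \<open>\<Lambda>\<close> and \<open>D\<close> is the variance of
    \<open>\<Lambda>\<close>.\<close>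
  define A where "A = (\<lambda>t. \<Sum>l<\<tau>. \<alpha> l * min (real \<tau> - real t) (real \<tau> - real l))"
  define D where "D = (\<Sum>k<\<tau>. \<Sum>l<\<tau>. \<alpha> k * \<alpha> l * min (real \<tau> - real k) (real \<tau> - real l))"
  have VV: "expectation (\<lambda>\<omega>. V t \<omega> * V l \<omega>) = q * min (real \<tau> - real t) (real \<tau> - real l)"
    if "t < \<tau>" "l < \<tau>" for t l
    unfolding V q by (rule brownian_increment_moment[OF brownian brownian_gaussian brownian_cov]) (use that in auto)
  have V\<Lambda>: "expectation (\<lambda>\<omega>. V t \<omega> * \<Lambda> \<omega>) = q * A t" if "t < \<tau>" for t
    using expectation_sum_mult_sum[of "{t}" "{..<\<tau>}" V V "\<lambda>_. 1" \<alpha>] that V_span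
    by (simp add: \<Lambda>_def VV A_def sum_distrib_left mult_ac min.commute)
  have \<Lambda>\<Lambda>: "expectation (\<lambda>\<omega>. (\<Lambda> \<omega>)\<^sup>2) = q * D"
    using expectation_sum_mult_sum[of "{..<\<tau>}" "{..<\<tau>}" V V \<alpha> \<alpha>] V_span
    by (simp add: \<Lambda>_def power2_eq_square VV D_def sum_distrib_left mult_ac)
  have D_pos: "0 < D"
  proof -
    obtain t where t: "t < \<tau>" "\<alpha> t \<noteq> 0" using \<alpha>_nonzero by auto
    let ?f = "\<lambda>k l. \<alpha> k * \<alpha> l * min (real \<tau> - real k) (real \<tau> - real l)"
    have nn: "0 \<le> ?f k l" if "k < \<tau>" "l < \<tau>" for k l
      using \<alpha>_nonneg that by simp
    \<comment> \<open>All summands of \<open>D\<close> are nonnegative, and a nonzero contribution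
      makes its diagonal summand positive because \<open>t\<close> lies strictly before the
      horizon.\<close>
    have "0 < ?f t t" using t \<alpha>_nonneg[of t] by simp
    also have "\<dots> \<le> (\<Sum>l<\<tau>. ?f t l)"
      by (rule member_le_sum[of t "{..<\<tau>}" "?f t"]) (use t nn in auto)
    also have "\<dots> \<le> D"
      unfolding D_def by (rule member_le_sum[of t "{..<\<tau>}" "\<lambda>k. \<Sum>l<\<tau>. ?f k l"]) (use t nn in \<open>auto intro!: sum_nonneg\<close>)
    finally show ?thesis .
  qed
  have \<Lambda>_mean: "expectation \<Lambda> = 0"
    using gauss[OF \<Lambda>_span] by (simp add: centered_gaussian_def)
  have std: "std_dev M \<Lambda> = sqrt (q * D)"
    by (simp add: std_dev_def \<Lambda>_mean \<Lambda>\<Lambda>)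

  \<comment> \<open>Jump factors and their transform\<close>
  define J where "J = (UNIV :: 'm set) \<times> {0, 1 :: nat}"
  \<comment> \<open>The common process, encoded as \<open>None\<close>, clocks the streams with
    \<open>l = 0\<close> of all assets; \<open>Some j\<close> clocks only the second stream of asset
    \<open>j\<close>.\<close>
  define src where "src = (\<lambda>(j :: 'm, l :: nat). if l = 0 then None else Some j)"
  define U where "U = (\<lambda>k (j, l) \<omega>. 1 + x $ j * (exp (Z k j l \<omega>) - 1))"
  define m where "m = (\<lambda>(j, l). mgf M (Zstar 1 j l) 1)"
  define rate where "rate = (case_option lam (($) lams))"
  have U_F2: "U k r \<in> borel_measurable F2" if "k \<ge> 1" "r \<in> J" for k r
    using that Z_F2[of k "snd r" "fst r"] by (cases r) (auto simp: U_def J_def)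
  have Z_meas [measurable]: "Z k j l \<in> borel_measurable M" if "k \<ge> 1" "l \<in> {0, 1}" for k j l
    using Z_continuous[OF that] by (simp add: continuous_rv_def)
  have U_exp: "AE \<omega> in M. U k (j, l) \<omega> = exp (Zstar k j l \<omega>)" if "k \<ge> 1" "l \<in> {0, 1}" for k j l
    using Zstar[OF that, of j] by (auto simp: U_def)
  have U_int: "integrable M (U k (j, l))" if "k \<ge> 1" "l \<in> {0, 1}" for k j l
    using Z_exp_integrable[OF that] by (simp add: U_def)
  have U_mean: "expectation (U k (j, l)) = m (j, l)" if kl: "k \<ge> 1" "l \<in> {0, 1}" for k j l
  proof -
    \<comment> \<open>Equality of laws across \<open>k\<close> and \<open>l\<close> reduces every
      mean to one law per asset; this lets \<open>m\<close>, defined with the first jump, serve for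
      all jumps.\<close>
    have Z_mean: "expectation (\<lambda>\<omega>. exp (Z k j l \<omega>)) = expectation (\<lambda>\<omega>. exp (Z 1 j 0 \<omega>))"
      if "k \<ge> 1" "l \<in> {0, 1}" for k l
      using Z_identical[OF that, of j] integral_distr[of "Z k j l" M borel exp] integral_distr[of "Z 1 j 0" M borel exp] that
      by simp
    have EU: "expectation (U k (j, l)) = 1 + x $ j * (expectation (\<lambda>\<omega>. exp (Z 1 j 0 \<omega>)) - 1)"
      if "k \<ge> 1" "l \<in> {0, 1}" for k l
      using Z_exp_integrable[OF that] unfolding Z_mean[OF that, symmetric] by (simp add: U_def prob_space)
    have "expectation (U k (j, l)) = expectation (U 1 (j, l))"
      using EU[OF kl] EU[of 1 l] kl(2) by simp
    also have "\<dots> = m (j, l)"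
      unfolding m_def mgf_def prod.case
      by (intro integral_cong_AE)
        (use kl U_exp[of 1 l j] Zstar_measurable[of 1 l] borel_measurable_integrable[OF U_int[of 1 l j]] in auto)
    finally show ?thesis .
  qed
  have m_nonneg: "0 \<le> m r" for r by (auto simp: m_def mgf_def split: prod.split)
  have U_nn_mean: "(\<integral>\<^sup>+\<omega>. ennreal (U k r \<omega>) \<partial>M) = ennreal (m r)" if "k \<ge> 1" "r \<in> J" for k r
  proof -
    obtain j l where r: "r = (j, l)" "l \<in> {0, 1}" using \<open>r \<in> J\<close> by (auto simp: J_def)
    have "AE \<omega> in M. 0 \<le> U k (j, l) \<omega>" using U_exp[OF that(1) r(2), of j] by eventually_elim simp
    then show ?thesis
      using nn_integral_eq_integral[OF U_int[OF that(1) r(2), of j]] U_mean[OF that(1) r(2), of j] by (simp add: r)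
  qed
  have U_indep: "indep_vars (\<lambda>_. borel) (\<lambda>(k, r). U k r) ({1..} \<times> J)"
  proof -
    have "indep_vars (\<lambda>_. borel) (\<lambda>i \<omega>. 1 + x $ fst (snd i) * (exp ((case i of (k, j, l) \<Rightarrow> Z k j l) \<omega>) - 1)) ({1..} \<times> J)"
      unfolding J_def
      by (rule indep_vars_compose2[OF Z_indep, where Y = "\<lambda>i z. 1 + x $ fst (snd i) * (exp z - 1)"]) simp
    moreover have "(\<lambda>i \<omega>. 1 + x $ fst (snd i) * (exp ((case i of (k, j, l) \<Rightarrow> Z k j l) \<omega>) - 1)) = (\<lambda>(k, r). U k r)"
      by (auto simp: U_def fun_eq_iff)
    ultimately show ?thesis by simp
  qed

  have N_M: "case_option N Ns c t \<in> measurable M (count_space UNIV)" if "0 \<le> t" for c t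
    using poisson_common poisson_single that by (auto simp: poisson_process_def split: option.split)
  have rate_pos: "0 < rate c" for c
    using poisson_common poisson_single by (auto simp: poisson_process_def rate_def split: option.split)

  \<comment> \<open>The riskless growth contained in \<open>c2\<close> is removed, leaving the
    Poisson exponent alone.\<close>
  have jumps: "(\<integral>\<^sup>+\<omega>. (\<Prod>r\<in>J. \<Prod>k = case_option N Ns (src r) (real t) \<omega> + 1..case_option N Ns (src r) (real \<tau>) \<omega>.
        ennreal (U k r \<omega>)) * Q \<omega> \<partial>M) = ennreal (exp (c2 t - (real \<tau> - real t) * r)) * (\<integral>\<^sup>+\<omega>. Q \<omega> \<partial>M)"
    if t: "t < \<tau>" and Q: "Q \<in> borel_measurable F0" for t Q
  proof -
    have meas: "(\<lambda>f. f (real \<tau>) - f (real t)) \<in> measurable (PiM {0..} (\<lambda>_. count_space UNIV)) (count_space (UNIV :: nat set))"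
      by measurable
    have "indep_vars (\<lambda>_. count_space UNIV)
        (\<lambda>c \<omega>. case_option N Ns c (real \<tau>) \<omega> - case_option N Ns c (real t) \<omega>) UNIV"
      using indep_vars_compose2[OF poisson_indep, of "\<lambda>_ f. f (real \<tau>) - f (real t)" "\<lambda>_. count_space UNIV"] meas by simp
    moreover have "distr M (count_space UNIV) (\<lambda>\<omega>. case_option N Ns c (real \<tau>) \<omega> - case_option N Ns c (real t) \<omega>) =
        measure_pmf (poisson_pmf (rate c * (real \<tau> - real t)))" for c
      using poisson_common poisson_single t by (auto simp: poisson_process_def rate_def split: option.split)
    ultimately have "(\<integral>\<^sup>+\<omega>. (\<Prod>r\<in>J. \<Prod>k = case_option N Ns (src r) (real t) \<omega> + 1..case_option N Ns (src r) (real \<tau>) \<omega>.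
        ennreal (U k r \<omega>)) * Q \<omega> \<partial>M) =
      ennreal (exp (\<Sum>c\<in>UNIV. rate c * (real \<tau> - real t) * ((\<Prod>r\<in>{r \<in> J. src r = c}. m r) - 1))) * (\<integral>\<^sup>+\<omega>. Q \<omega> \<partial>M)"
      using t rate_pos
      by (intro compound_poisson_transform[OF _ indep space Q N_F1 N_F1 U_F2 _ _ _ U_indep U_nn_mean m_nonneg])
        (auto simp: J_def)
    also have "(\<Sum>c\<in>UNIV. rate c * (real \<tau> - real t) * ((\<Prod>r\<in>{r \<in> J. src r = c}. m r) - 1)) =
        c2 t - (real \<tau> - real t) * r"
    proof -
      \<comment> \<open>The fibre over the common clock yields the product over all assets in
        \<open>c2\<close>; each individual clock yields one factor.\<close>
      have "{r \<in> J. src r = None} = UNIV \<times> {0}" and "\<And>j. {r \<in> J. src r = Some j} = {(j, 1)}"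
        by (auto simp: J_def src_def split: if_splits)
      moreover have "(\<Prod>r\<in>UNIV \<times> {0}. m r) = (\<Prod>j\<in>UNIV. mgf M (Zstar 1 j 0) 1)"
        using prod.cartesian_product[of "\<lambda>j l. m (j, l)" "{0}" UNIV] by (simp add: m_def)
      ultimately show ?thesis
        by (simp add: UNIV_option_conv sum.reindex rate_def c2_def m_def)
    qed
    finally show ?thesis .
  qed

  have S_eq: "AE \<omega> in M. \<forall>t. ennreal (exp (S t \<omega>)) = ennreal (exp ((real \<tau> - real t) * (\<mu>x - q / 2))) *
      (\<Prod>r\<in>J. \<Prod>k = case_option N Ns (src r) (real t) \<omega> + 1..case_option N Ns (src r) (real \<tau>) \<omega>. ennreal (U k r \<omega>))"
  proof -
    \<comment> \<open>The number of jumps is random, so the identities for all \<open>k\<close> must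
      hold outside one null set; countability provides it.\<close>
    have "countable ({1 :: nat..} \<times> J)"
      unfolding J_def by (intro countable_SIGMA) (auto intro: countable_finite)
    then have "AE \<omega> in M. \<forall>(k, r)\<in>{1..} \<times> J. U k r \<omega> = exp (Zstar k (fst r) (snd r) \<omega>)"
      by (subst AE_ball_countable) (auto simp: J_def U_exp)
    then show ?thesis
    proof eventually_elim
      case (elim \<omega>)
      show ?case
      proof
        fix t
        let ?K = "\<lambda>r. {case_option N Ns (src r) (real t) \<omega> + 1..case_option N Ns (src r) (real \<tau>) \<omega>}"
        have J0: "(\<Sum>r\<in>J. h r) = (\<Sum>j\<in>UNIV. h (j, 0)) + (\<Sum>j\<in>UNIV. h (j, 1))" for h :: "'m \<times> nat \<Rightarrow> real"
          unfolding J_def using sum.cartesian_product[of "\<lambda>j l. h (j, l)" "{0, 1}" UNIV] by (simp add: sum.distrib)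
        have "S t \<omega> = (real \<tau> - real t) * (\<mu>x - q / 2) + (\<Sum>r\<in>J. \<Sum>k\<in>?K r. Zstar k (fst r) (snd r) \<omega>)"
          unfolding S_def J0 by (simp add: src_def)
        then have "exp (S t \<omega>) = exp ((real \<tau> - real t) * (\<mu>x - q / 2)) * (\<Prod>r\<in>J. \<Prod>k\<in>?K r. exp (Zstar k (fst r) (snd r) \<omega>))"
          by (simp add: exp_add exp_sum J_def)
        moreover have "(\<Prod>r\<in>J. \<Prod>k\<in>?K r. ennreal (U k r \<omega>)) =
            ennreal (\<Prod>r\<in>J. \<Prod>k\<in>?K r. exp (Zstar k (fst r) (snd r) \<omega>))"
        proof -
          have "(\<Prod>r\<in>J. \<Prod>k\<in>?K r. ennreal (U k r \<omega>)) =
              (\<Prod>r\<in>J. \<Prod>k\<in>?K r. ennreal (exp (Zstar k (fst r) (snd r) \<omega>)))"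
            using elim by (intro prod.cong refl) auto
          then show ?thesis by (simp add: prod_ennreal prod_nonneg)
        qed
        ultimately show "ennreal (exp (S t \<omega>)) = ennreal (exp ((real \<tau> - real t) * (\<mu>x - q / 2))) *
            (\<Prod>r\<in>J. \<Prod>k\<in>?K r. ennreal (U k r \<omega>))"
          by (simp add: ennreal_mult')
      qed
    qed
  qed

  have S_meas: "S t \<in> borel_measurable M" for t
  proof -
    \<comment> \<open>The random limits take countably many values and are fixed one after the
      other.\<close>
    have sum_meas: "(\<lambda>\<omega>. \<Sum>k = a \<omega> + 1..b \<omega>. Zstar k j l \<omega>) \<in> borel_measurable M"
      if [measurable]: "a \<in> measurable M (count_space UNIV)" "b \<in> measurable M (count_space UNIV)"
        and l: "l \<in> {0, 1}" for a b :: "'a \<Rightarrow> nat" and j l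
    proof (rule measurable_compose_countable[OF _ that(1)])
      fix n
      show "(\<lambda>\<omega>. \<Sum>k = n + 1..b \<omega>. Zstar k j l \<omega>) \<in> borel_measurable M"
      proof (rule measurable_compose_countable[OF _ that(2)])
        fix n'
        show "(\<lambda>\<omega>. \<Sum>k = n + 1..n'. Zstar k j l \<omega>) \<in> borel_measurable M"
          by (intro borel_measurable_sum Zstar_measurable l) auto
      qed
    qed
    have "(\<lambda>\<omega>. \<Sum>k = N (real t) \<omega> + 1..N (real \<tau>) \<omega>. Zstar k j 0 \<omega>) \<in> borel_measurable M" for j
      using sum_meas[OF N_M[of "real t" None] N_M[of "real \<tau>" None], of 0] by simp
    moreover have "(\<lambda>\<omega>. \<Sum>k = Ns j (real t) \<omega> + 1..Ns j (real \<tau>) \<omega>. Zstar k j 1 \<omega>) \<in> borel_measurable M" for j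
      using sum_meas[OF N_M[of "real t" "Some j"] N_M[of "real \<tau>" "Some j"], of 1] by simp
    ultimately show ?thesis unfolding S_def
      by (intro borel_measurable_add borel_measurable_sum borel_measurable_const)
  qed

  \<comment> \<open>Conditional expectation of one summand\<close>
  have cond: "AE \<omega> in M. cond_exp_rv M (X t) \<Lambda> \<omega> =
      \<alpha> t * exp (\<Lambda> \<omega> / std_dev M \<Lambda> * sqrt q * c4 t + c3 t + c2 t)" if t: "t < \<tau>" for t
  proof -
    \<comment> \<open>The logarithm of the mean of \<open>exp (S t)\<close>, the regression
      coefficient of \<open>V t\<close> on \<open>\<Lambda>\<close>, and the residual
      variance.\<close>
    define d where "d = (real \<tau> - real t) * (\<mu>x - q / 2) + (c2 t - (real \<tau> - real t) * r)"
    define a where "a = q * A t / (q * D)"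
    define v where "v = q * (real \<tau> - real t) - (q * A t)\<^sup>2 / (q * D)"
    have moments: "expectation (\<lambda>\<omega>. V t \<omega> * \<Lambda> \<omega>) = q * A t" "expectation (\<lambda>\<omega>. (\<Lambda> \<omega>)\<^sup>2) = q * D"
      "expectation (\<lambda>\<omega>. (V t \<omega>)\<^sup>2) = q * (real \<tau> - real t)"
      using V\<Lambda>[OF t] \<Lambda>\<Lambda> VV[OF t t] by (simp_all add: power2_eq_square)
    have factor: "(\<integral>\<^sup>+\<omega>. ennreal (exp (S t \<omega> + V t \<omega>)) * indicator E (\<Lambda> \<omega>) \<partial>M) =
        ennreal (exp d) * (\<integral>\<^sup>+\<omega>. ennreal (exp (V t \<omega>)) * indicator E (\<Lambda> \<omega>) \<partial>M)"
      if [measurable]: "E \<in> sets borel" for E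
    proof -
      let ?P = "\<lambda>\<omega>. \<Prod>r\<in>J. \<Prod>k = case_option N Ns (src r) (real t) \<omega> + 1..case_option N Ns (src r) (real \<tau>) \<omega>. ennreal (U k r \<omega>)"
      \<comment> \<open>The deterministic drift is put with the Gaussian factors, so that everything
        outside the jump product is measurable with respect to \<open>F0\<close>.\<close>
      let ?Q = "\<lambda>\<omega>. ennreal (exp ((real \<tau> - real t) * (\<mu>x - q / 2))) * (ennreal (exp (V t \<omega>)) * indicator E (\<Lambda> \<omega>))"
      have "(\<integral>\<^sup>+\<omega>. ennreal (exp (S t \<omega> + V t \<omega>)) * indicator E (\<Lambda> \<omega>) \<partial>M) = (\<integral>\<^sup>+\<omega>. ?P \<omega> * ?Q \<omega> \<partial>M)"
      proof (rule nn_integral_cong_AE)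
        show "AE \<omega> in M. ennreal (exp (S t \<omega> + V t \<omega>)) * indicator E (\<Lambda> \<omega>) = ?P \<omega> * ?Q \<omega>"
          using S_eq by eventually_elim (simp add: exp_add ennreal_mult' mult_ac)
      qed
      also have "\<dots> = ennreal (exp (c2 t - (real \<tau> - real t) * r)) * (\<integral>\<^sup>+\<omega>. ?Q \<omega> \<partial>M)"
        by (rule jumps[OF t]) measurable
      also have "\<dots> = ennreal (exp d) * (\<integral>\<^sup>+\<omega>. ennreal (exp (V t \<omega>)) * indicator E (\<Lambda> \<omega>) \<partial>M)"
        by (subst nn_integral_cmult)
          (simp_all add: d_def exp_add ennreal_mult' mult_ac)
      finally show ?thesis .
    qed
    have regression: "(\<integral>\<^sup>+\<omega>. ennreal (exp (V t \<omega>)) * indicator E (\<Lambda> \<omega>) \<partial>M) =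
        (\<integral>\<^sup>+\<omega>. ennreal (exp (a * \<Lambda> \<omega> + v / 2)) * indicator E (\<Lambda> \<omega>) \<partial>M)" if "E \<in> sets borel" for E
      unfolding a_def v_def moments[symmetric]
    proof (rule centered_gaussian_regression[OF _ _ that])
      show "centered_gaussian M (\<lambda>\<omega>. u * V t \<omega> + w * \<Lambda> \<omega>)" for u w
        by (intro gauss lin_span_add lin_span_scale V_span \<Lambda>_span)
      show "0 < expectation (\<lambda>\<omega>. (\<Lambda> \<omega>)\<^sup>2)" using q_pos D_pos by (simp add: moments)
    qed
    have exponent: "d + (a * \<Lambda> \<omega> + v / 2) = \<Lambda> \<omega> / std_dev M \<Lambda> * sqrt q * c4 t + c3 t + c2 t" for \<omega>
    proof -
      \<comment> \<open>The variance of \<open>V t\<close> explained by \<open>\<Lambda>\<close>. In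
        \<open>d + v / 2\<close> the terms with \<open>q * (real \<tau> - real t) / 2\<close> cancel
        and \<open>- e / 2\<close> remains; the \<open>r\<close> subtracted in \<open>d\<close>
        turns \<open>\<mu>x\<close> into the excess drift of \<open>c3\<close>.\<close>
      define e where "e = q * (A t)\<^sup>2 / D"
      have "\<Lambda> \<omega> / std_dev M \<Lambda> * sqrt q * c4 t = a * \<Lambda> \<omega>"
      proof -
        \<comment> \<open>With \<open>p = sqrt q\<close> and \<open>w = sqrt D\<close>: the standard
          deviation of \<open>\<Lambda>\<close> is \<open>p * w\<close>, and the second
          \<open>w\<close> is the denominator of \<open>c4\<close>.\<close>
        have "L / (p * w) * p * (B / w) = L * B / (w * w)" if "p \<noteq> 0" "w \<noteq> 0" for L p w B :: real
          using that by (simp add: field_simps)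
        from this[of "sqrt q" "sqrt D" "\<Lambda> \<omega>" "A t"]
        have "\<Lambda> \<omega> / std_dev M \<Lambda> * sqrt q * c4 t = \<Lambda> \<omega> * A t / D"
          using q_pos D_pos by (simp add: std real_sqrt_mult c4_def A_def D_def)
        then show ?thesis using q_pos by (simp add: a_def)
      qed
      moreover have "c3 t = (real \<tau> - real t) * (\<mu>x - r) - e / 2"
        by (simp add: c3_def A_def D_def \<mu>x_def e_def)
      moreover have "v / 2 = q * (real \<tau> - real t) / 2 - e / 2"
        using q_pos D_pos by (simp add: v_def e_def power2_eq_square field_simps)
      ultimately show ?thesis unfolding d_def by (simp add: field_simps)
    qed
    let ?g = "\<lambda>\<omega>. \<alpha> t * exp (d + (a * \<Lambda> \<omega> + v / 2))"
    have nn: "0 \<le> \<alpha> t" using \<alpha>_nonneg[OF t] .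
    have X_nn: "ennreal (X t \<omega>) = ennreal (\<alpha> t) * ennreal (exp (S t \<omega> + V t \<omega>))" for \<omega>
      using nn by (simp add: X_def ennreal_mult')
    have [measurable]: "S t \<in> borel_measurable M" by (rule S_meas)
    have eq: "(\<integral>\<^sup>+\<omega>. ennreal (X t \<omega>) * indicator E (\<Lambda> \<omega>) \<partial>M) = (\<integral>\<^sup>+\<omega>. ennreal (?g \<omega>) * indicator E (\<Lambda> \<omega>) \<partial>M)"
      if [measurable]: "E \<in> sets borel" for E
    proof -
      have "(\<integral>\<^sup>+\<omega>. ennreal (X t \<omega>) * indicator E (\<Lambda> \<omega>) \<partial>M) =
          ennreal (\<alpha> t) * (\<integral>\<^sup>+\<omega>. ennreal (exp (S t \<omega> + V t \<omega>)) * indicator E (\<Lambda> \<omega>) \<partial>M)"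
        unfolding X_nn mult.assoc by (rule nn_integral_cmult) measurable
      also have "\<dots> = ennreal (\<alpha> t) * (ennreal (exp d) *
          (\<integral>\<^sup>+\<omega>. ennreal (exp (a * \<Lambda> \<omega> + v / 2)) * indicator E (\<Lambda> \<omega>) \<partial>M))"
        by (simp add: factor regression)
      also have "\<dots> = (\<integral>\<^sup>+\<omega>. ennreal (\<alpha> t) * (ennreal (exp d) *
          (ennreal (exp (a * \<Lambda> \<omega> + v / 2)) * indicator E (\<Lambda> \<omega>))) \<partial>M)"
        by (simp add: nn_integral_cmult)
      also have "\<dots> = (\<integral>\<^sup>+\<omega>. ennreal (?g \<omega>) * indicator E (\<Lambda> \<omega>) \<partial>M)"
        using nn by (intro nn_integral_cong) (simp add: exp_add ennreal_mult' mult.assoc)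
      finally show ?thesis .
    qed
    \<comment> \<open>Finiteness of the mean reduces to the finite exponential moment of the
      Gaussian \<open>V t\<close>, the jump part being the constant \<open>exp d\<close>.\<close>
    have fin: "(\<integral>\<^sup>+\<omega>. ennreal (X t \<omega>) \<partial>M) < \<infinity>"
    proof -
      have "(\<integral>\<^sup>+\<omega>. ennreal (X t \<omega>) \<partial>M) = ennreal (\<alpha> t) * (ennreal (exp d) * (\<integral>\<^sup>+\<omega>. ennreal (exp (V t \<omega>)) \<partial>M))"
        using factor[of UNIV] unfolding X_nn by (simp add: nn_integral_cmult)
      then show ?thesis
        by (simp add: centered_gaussian_exp[OF gauss[OF V_span]] ennreal_mult_less_top)
    qed
    have "AE \<omega> in M. cond_exp_rv M (X t) \<Lambda> \<omega> = ?g \<omega>"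
      by (rule cond_exp_rv_charact[where \<phi> = "\<lambda>z. \<alpha> t * exp (d + (a * z + v / 2))", OF _ _ _ _ _ _ fin eq])
        (use nn in \<open>auto simp: X_def\<close>)
    then show ?thesis unfolding exponent .
  qed
  have "AE \<omega> in M. \<forall>t\<in>{..<\<tau>}. cond_exp_rv M (X t) \<Lambda> \<omega> =
      \<alpha> t * exp (\<Lambda> \<omega> / std_dev M \<Lambda> * sqrt q * c4 t + c3 t + c2 t)"
    by (rule AE_finite_allI) (use cond in auto)
  then show ?thesis
    by eventually_elim (simp add: WL_def comonotonic_lower_bound_def)
qed

end
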